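(* In the setting of the context, for any $s\ge0$ and any $f\in\mathcal{E}_+$, $$\mathbf{U}(t,s)f\in\mathscr{D}(\mathbf{B}(t))\qquad\text{for almost every }t\in[s,\infty),$$ and the mapping $t\in[s,\infty)\mapsto\mathbf{B}(t)\mathbf{U}(t,s)f$ is measurable. Moreover, $$\int_s^r\|\mathbf{B}(t)\mathbf{U}(t,s)f\|_{\mathcal{E}}\,\mathrm{d}t\le\int_s^r\|\mathbf{\Sigma}(t)\mathbf{U}(t,s)f\|_{\mathcal{E}}\,\mathrm{d}t\le\|f\|_{\mathcal{E}}-\|\mathbf{U}(r,s)f\|_{\mathcal{E}}\qquad\forall f\in\mathcal{E}_+,\ r\ge s\ge0.$$
   Context: Let $\mathbf{\Omega}\subset\mathbb{R}^d$ be open, $\mu$ a Borel measure on $\mathbb{R}^d$ ($d\ge1$) with support $V$, and $\mathcal{E}=L^1(\mathbf{\Omega}\times V,\mathrm{d}x\otimes\mathrm{d}\mu(v))$ with usual norm and positive cone $\mathcal{E}_+$. Assume: (1) $(t,v)\in\mathbb{R}_+\times V\mapsto\Sigma(t,v)$ is measurable and non-negative and, for $\mu$-a.e. $v\in V$, $t\mapsto\Sigma(t,v)$ is locally integrable on $\mathbb{R}_+$; (2) $(t,v,v')\in\mathbb{R}_+\times V\times V\mapsto b(t,v,v')$ is measurable and non-negative and $\int_Vb(t,v,v')\,\mathrm{d}\mu(v)\le\Sigma(t,v')$ for a.e. $(t,v')\in\mathbb{R}_+\times V$. Put $\sigma(t,v)=\int_Vb(t,v',v)\,\mathrm{d}\mu(v')$.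 With $\tau(x,v)=\inf\{t>0:x-tv\notin\mathbf{\Omega}\}$ ($\inf\emptyset=+\infty$), set for $t\ge s\ge0$, $\varphi\in\mathcal{E}$, $$[\mathbf{U}(t,s)\varphi](x,v)=\exp\Big(-\int_s^t\Sigma(r,v)\,\mathrm{d}r\Big)\varphi(x-(t-s)v,v)\,\chi_{\{t-s<\tau(x,v)\}}(x,v).$$ $\mathbf{\Sigma}(t)$ is the multiplication operator $[\mathbf{\Sigma}(t)\varphi](x,v)=\Sigma(t,v)\varphi(x,v)$ with domain $\mathscr{D}(\mathbf{\Sigma}(t))=\{\varphi\in\mathcal{E}:\int_{\mathbf{\Omega}\times V}\Sigma(t,v)|\varphi|\,\mathrm{d}x\,\mathrm{d}\mu(v)<\infty\}$; for $f\in\mathcal{E}_+$, $\mathbf{U}(t,s)f\in\mathscr{D}(\mathbf{\Sigma}(t))$ for a.e. $t\ge s$. $\mathbf{B}(t)$ is $[\mathbf{B}(t)\varphi](x,v)=\int_Vb(t,v,v')\varphi(x,v')\,\mathrm{d}\mu(v')$ with domain $\mathscr{D}(\mathbf{B}(t))=\{\varphi\in\mathcal{E}:\int_{\mathbf{\Omega}\times V}\sigma(t,v)|\varphi(x,v)|\,\mathrm{d}x\,\mathrm{d}\mu(v)<\infty\}$. *)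

theory Defs
  imports "HOL-Analysis.Analysis"
begin

text \<open>
  \<open>L\<^sup>1\<close> spaces are represented by integrable representatives; equality of classes is equality
  almost everywhere, and none of the notions below depends on the representative beyond null sets.
\<close>

definition L1_space :: "'a measure \<Rightarrow> ('a \<Rightarrow> real) set"
  where "L1_space M = {\<phi>. integrable M \<phi>}"

definition L1_cone :: "'a measure \<Rightarrow> ('a \<Rightarrow> real) set"
  where "L1_cone M = {\<phi> \<in> L1_space M. AE z in M. 0 \<le> \<phi> z}"

definition L1_norm :: "'a measure \<Rightarrow> ('a \<Rightarrow> real) \<Rightarrow> real"
  where "L1_norm M \<phi> = (\<integral>z. \<bar>\<phi> z\<bar> \<partial>M)"

text \<open>
  Strong (Bochner) measurability of an \<open>L\<^sup>1(M)\<close>-valued map on the measure space \<open>N\<close> that only has to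
  be defined \<open>N\<close>-almost everywhere: it is an almost everywhere limit, in the norm of \<open>L\<^sup>1(M)\<close>, of
  \<open>L\<^sup>1(M)\<close>-valued simple functions.
\<close>

definition L1_strongly_measurable ::
    "'t measure \<Rightarrow> 'a measure \<Rightarrow> ('t \<Rightarrow> 'a \<Rightarrow> real) \<Rightarrow> bool"
  where "L1_strongly_measurable N M F \<longleftrightarrow>
    (\<exists>S. (\<forall>n::nat. simple_function N (S n) \<and> (\<forall>t\<in>space N. S n t \<in> L1_space M)) \<and>
         (AE t in N. F t \<in> L1_space M \<and>
            (\<lambda>n. L1_norm M (\<lambda>z. S n t z - F t z)) \<longlonglongrightarrow> 0))"

definition measure_support :: "'a::topological_space measure \<Rightarrow> 'a set"
  where "measure_support \<mu> = {v. \<forall>W. open W \<and> v \<in> W \<longrightarrow> 0 < emeasure \<mu> W}"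

definition half_line :: "real \<Rightarrow> real measure"
  where "half_line s = restrict_space lborel {s..}"

definition velocity_measure :: "'a::topological_space measure \<Rightarrow> 'a measure"
  where "velocity_measure \<mu> = restrict_space \<mu> (measure_support \<mu>)"

definition phase_measure :: "'a::euclidean_space set \<Rightarrow> 'a measure \<Rightarrow> ('a \<times> 'a) measure"
  where "phase_measure \<Omega> \<mu> = restrict_space lborel \<Omega> \<Otimes>\<^sub>M velocity_measure \<mu>"

text \<open>The infimum is taken in \<^typ>\<open>ereal\<close>, so that it is \<open>\<infinity>\<close> on the empty set.\<close>

definition exit_time :: "'a::euclidean_space set \<Rightarrow> 'a \<Rightarrow> 'a \<Rightarrow> ereal"
  where "exit_time \<Omega> x v = (INF t\<in>{t. 0 < t \<and> x - t *\<^sub>R v \<notin> \<Omega>}. ereal t)"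

definition U_op ::
    "'a::euclidean_space set \<Rightarrow> (real \<Rightarrow> 'a \<Rightarrow> real) \<Rightarrow> real \<Rightarrow> real \<Rightarrow>
      ('a \<times> 'a \<Rightarrow> real) \<Rightarrow> 'a \<times> 'a \<Rightarrow> real"
  where "U_op \<Omega> \<Sigma> t s \<phi> = (\<lambda>(x, v).
    exp (- (LBINT r:{s..t}. \<Sigma> r v)) * \<phi> (x - (t - s) *\<^sub>R v, v) *
    (if ereal (t - s) < exit_time \<Omega> x v then 1 else 0))"

definition Sigma_op ::
    "(real \<Rightarrow> 'a \<Rightarrow> real) \<Rightarrow> real \<Rightarrow> ('a \<times> 'a \<Rightarrow> real) \<Rightarrow> 'a \<times> 'a \<Rightarrow> real"
  where "Sigma_op \<Sigma> t \<phi> = (\<lambda>(x, v). \<Sigma> t v * \<phi> (x, v))"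

definition Sigma_dom ::
    "'a::euclidean_space set \<Rightarrow> 'a measure \<Rightarrow> (real \<Rightarrow> 'a \<Rightarrow> real) \<Rightarrow> real \<Rightarrow>
      ('a \<times> 'a \<Rightarrow> real) set"
  where "Sigma_dom \<Omega> \<mu> \<Sigma> t = {\<phi> \<in> L1_space (phase_measure \<Omega> \<mu>).
    (\<integral>\<^sup>+(x, v). ennreal (\<Sigma> t v * \<bar>\<phi> (x, v)\<bar>) \<partial>phase_measure \<Omega> \<mu>) < \<infinity>}"

text \<open>May be infinite for exceptional \<open>(t, v)\<close>.\<close>

definition coll_freq ::
    "'a::topological_space measure \<Rightarrow> (real \<Rightarrow> 'a \<Rightarrow> 'a \<Rightarrow> real) \<Rightarrow> real \<Rightarrow> 'a \<Rightarrow> ennreal"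
  where "coll_freq \<mu> b t v = (\<integral>\<^sup>+v'. ennreal (b t v' v) \<partial>velocity_measure \<mu>)"

definition B_op ::
    "'a::topological_space measure \<Rightarrow> (real \<Rightarrow> 'a \<Rightarrow> 'a \<Rightarrow> real) \<Rightarrow> real \<Rightarrow>
      ('a \<times> 'a \<Rightarrow> real) \<Rightarrow> 'a \<times> 'a \<Rightarrow> real"
  where "B_op \<mu> b t \<phi> = (\<lambda>(x, v). \<integral>v'. b t v v' * \<phi> (x, v') \<partial>velocity_measure \<mu>)"

definition B_dom ::
    "'a::euclidean_space set \<Rightarrow> 'a measure \<Rightarrow> (real \<Rightarrow> 'a \<Rightarrow> 'a \<Rightarrow> real) \<Rightarrow> real \<Rightarrow>
      ('a \<times> 'a \<Rightarrow> real) set"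
  where "B_dom \<Omega> \<mu> b t = {\<phi> \<in> L1_space (phase_measure \<Omega> \<mu>).
    (\<integral>\<^sup>+(x, v). coll_freq \<mu> b t v * ennreal \<bar>\<phi> (x, v)\<bar> \<partial>phase_measure \<Omega> \<mu>) < \<infinity>}"

end

theory Submission
  imports Defs
begin

text \<open>
  Along the characteristic \<open>t \<mapsto> y + (t - s) v\<close> through \<open>(y, v)\<close> the evolution \<open>U(t, s)\<close> transports
  the initial mass \<open>\<bar>f (y, v)\<bar>\<close>, weakened by the factor \<open>a(t) = exp (- \<integral>\<^sub>s\<^sup>t \<Sigma>(u, v) du)\<close>, until the
  characteristic leaves \<open>\<Omega>\<close>. Since \<open>\<Sigma> a = - a'\<close>, the mass removed by \<open>\<Sigma>\<close> up to time \<open>r\<close> is at most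
  \<open>1 - a(r)\<close> times the initial mass, and what is left at time \<open>r\<close> is at most \<open>a(r)\<close> times it, so
  the two together never exceed the initial mass; they fall short of it only by what has left through
  the boundary. The translation \<open>x = y + (t - s) v\<close> and Tonelli's theorem turn this statement about
  one trajectory (\<open>removal_plus_remaining_le\<close>) into the inequality
  \<open>\<integral>\<^sub>s\<^sup>r \<parallel>\<Sigma>(t) U(t, s) f\<parallel> dt + \<parallel>U(r, s) f\<parallel> \<le> \<parallel>f\<parallel>\<close> (\<open>energy_estimate\<close>).

  The relation \<open>\<Sigma> a = - a'\<close> is needed for an attenuation rate that is merely integrable. Instead of
  differentiating \<open>a\<close> almost everywhere, \<open>damped_integral_le\<close> compares both sides on a partition into
  pieces of equal optical depth, where the error is quadratic in the depth of a piece.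

  For the collision operator, Tonelli's theorem gives \<open>\<parallel>B(t) \<phi>\<parallel> \<le> \<integral> \<sigma>(t, v) \<bar>\<phi>\<bar>\<close>, and \<open>\<sigma> \<le> \<Sigma>\<close>
  almost everywhere. Hence every bound for \<open>\<Sigma>(t) U(t, s) f\<close> passes to \<open>B(t) U(t, s) f\<close>; in
  particular \<open>(t, z) \<mapsto> (B(t) U(t, s) f) z\<close> is integrable over the product of \<open>[s, \<infinity>)\<close> and the phase
  space. Membership in the domains for almost every \<open>t\<close> is then Fubini's theorem. Strong measurability
  is a property of every function that is integrable over a product: such a function is the limit
  in the mean of functions with finitely many values in \<open>L\<^sup>1\<close>, and a rapidly convergent sequence of
  those converges at almost every \<open>t\<close> (\<open>integrable_imp_L1_strongly_measurable\<close>).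
\<close>

section \<open>Exponential attenuation along one trajectory\<close>

text \<open>
  Formally the integrand is \<open>- (exp (- G))'\<close>, and the second claim even holds with equality. As \<open>g\<close> is
  only integrable, \<open>G\<close> need not be differentiable at a given point, but it is continuous and increasing.
  So \<open>{s..r}\<close> can be cut into \<open>n\<close> intervals on each of which \<open>G\<close> grows by \<open>G r / n\<close>. On one such interval
  replacing \<open>exp (- G)\<close> by its value at the left end costs at most \<open>(G r / n)\<^sup>2\<close>, and the total error
  \<open>(G r)\<^sup>2 / n\<close> vanishes in the limit.
\<close>

lemma damped_integral_le:
  fixes g :: "real \<Rightarrow> real"
  assumes "s \<le> r" and g: "set_integrable lborel {s..r} g"
    and nonneg: "\<And>t. t \<in> {s..r} \<Longrightarrow> 0 \<le> g t"
  defines "G \<equiv> \<lambda>t. LBINT u:{s..t}. g u"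
  shows "set_integrable lborel {s..r} (\<lambda>t. g t * exp (- G t))"
    and "(LBINT t:{s..r}. g t * exp (- G t)) \<le> 1 - exp (- G r)"
proof -
  have sub: "set_integrable lborel {a..c} g" if "s \<le> a" "c \<le> r" for a c
    using g by (rule set_integrable_subset) (use that in auto)
  have hk: "g integrable_on {a..c}" "(LBINT u:{a..c}. g u) = integral {a..c} g"
    if "s \<le> a" "c \<le> r" for a c
    using set_borel_integral_eq_integral[OF sub[OF that]] by auto
  have G_eq: "G t = integral {s..t} g" if "t \<le> r" for t
    unfolding G_def using hk(2)[of s t] that by simp
  have cont: "continuous_on {s..r} G"
    using indefinite_integral_continuous_1[OF hk(1)[of s r]]
    by (rule continuous_on_eq) (auto simp: G_eq)
  have step: "G c = G a + integral {a..c} g" if "s \<le> a" "a \<le> c" "c \<le> r" for a c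
    using Henstock_Kurzweil_Integration.integral_combine[of s a c g] hk(1)[of s c] that G_eq by auto
  have mono: "G a \<le> G c" if "s \<le> a" "a \<le> c" "c \<le> r" for a c
    using step[OF that] Henstock_Kurzweil_Integration.integral_nonneg[OF hk(1)[of a c]] nonneg that by auto
  have G_s: "G s = 0" using G_eq[of s] assms(1) by simp
  have Gnn: "0 \<le> G t" if "t \<in> {s..r}" for t
    using mono[of s t] that G_s by auto
  have meas: "set_borel_measurable lborel {s..r} (\<lambda>t. g t * exp (- G t))"
  proof -
    have "(\<lambda>t. indicator {s..r} t *\<^sub>R exp (- G t)) \<in> borel_measurable borel"
      using cont by (intro borel_measurable_continuous_on_indicator continuous_intros) auto
    moreover have "(\<lambda>t. indicator {s..r} t *\<^sub>R g t) \<in> borel_measurable borel"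
      using g by (auto simp: set_integrable_def dest: borel_measurable_integrable)
    ultimately have "(\<lambda>t. (indicator {s..r} t *\<^sub>R g t) * (indicator {s..r} t *\<^sub>R exp (- G t)))
        \<in> borel_measurable borel" by measurable
    also have "(\<lambda>t. (indicator {s..r} t *\<^sub>R g t) * (indicator {s..r} t *\<^sub>R exp (- G t)))
        = (\<lambda>t. indicator {s..r} t *\<^sub>R (g t * exp (- G t)))" by (auto simp: indicator_def)
    finally show ?thesis unfolding set_borel_measurable_def by simp
  qed
  show int: "set_integrable lborel {s..r} (\<lambda>t. g t * exp (- G t))"
    using g meas by (rule set_integrable_bound)
      (use nonneg Gnn in \<open>auto intro!: mult_left_le\<close>)
  let ?D = "\<lambda>a c. integral {a..c} (\<lambda>t. g t * exp (- G t))"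
  have int': "(\<lambda>t. g t * exp (- G t)) integrable_on {a..c}" if "s \<le> a" "c \<le> r" for a c
  proof -
    have "set_integrable lborel {a..c} (\<lambda>t. g t * exp (- G t))"
      using int by (rule set_integrable_subset) (use that in auto)
    then show ?thesis by (rule set_borel_integral_eq_integral)
  qed
  \<comment> \<open>On a subinterval the two sides differ by a term quadratic in the increment of \<open>G\<close>.\<close>
  have incr: "?D a c \<le> exp (- G a) - exp (- G c) + (G c - G a)\<^sup>2"
    if "s \<le> a" "a \<le> c" "c \<le> r" for a c
  proof -
    have "?D a c \<le> integral {a..c} (\<lambda>t. exp (- G a) * g t)"
    proof (rule integral_le)
      show "(\<lambda>t. exp (- G a) * g t) integrable_on {a..c}"
        using hk(1)[of a c] that by (intro integrable_on_mult_right) auto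
      fix t assume "t \<in> {a..c}"
      then show "g t * exp (- G t) \<le> exp (- G a) * g t"
        using mono[of a t] nonneg[of t] that by (auto simp: mult.commute intro!: mult_left_mono)
    qed (use int' that in auto)
    also have "\<dots> = exp (- G a) * (G c - G a)" using step[OF that] by simp
    also have "\<dots> \<le> exp (- G c) * (G c - G a) + (G c - G a)\<^sup>2"
    proof -
      have "exp (- G a) - exp (- G c) \<le> G c - G a"
      proof -
        have "exp (- G a) * (1 - exp (- (G c - G a))) \<le> 1 * (G c - G a)"
        proof (rule mult_mono)
          show "1 - exp (- (G c - G a)) \<le> G c - G a"
            using exp_ge_add_one_self[of "- (G c - G a)"] by linarith
        qed (use Gnn[of a] mono[OF that] that in auto)
        then show ?thesis by (simp add: algebra_simps flip: exp_add)
      qed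
      then have "(exp (- G a) - exp (- G c)) * (G c - G a) \<le> (G c - G a) * (G c - G a)"
        using mono[OF that] by (intro mult_right_mono) auto
      then show ?thesis by (simp add: algebra_simps power2_eq_square)
    qed
    also have "exp (- G c) * (G c - G a) \<le> exp (- G a) - exp (- G c)"
    proof -
      have "exp (- G c) * (1 + (G c - G a)) \<le> exp (- G c) * exp (G c - G a)"
        using exp_ge_add_one_self by (intro mult_left_mono) auto
      then show ?thesis by (simp add: algebra_simps flip: exp_add)
    qed
    finally show ?thesis by simp
  qed
  \<comment> \<open>The cut points are found by the intermediate value theorem; the error adds up over the first \<open>i\<close> intervals.\<close>
  have part: "\<exists>t\<in>{s..r}. G t = i * (G r / n) \<and> ?D s t \<le> 1 - exp (- G t) + i * (G r / n)\<^sup>2"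
    if n: "n > 0" and "i \<le> n" for i n :: nat
    using \<open>i \<le> n\<close>
  proof (induction i)
    case 0
    then show ?case using assms(1) G_s by (intro bexI[of _ s]) auto
  next
    case (Suc i)
    then obtain t where t: "t \<in> {s..r}" "G t = i * (G r / n)"
      "?D s t \<le> 1 - exp (- G t) + i * (G r / n)\<^sup>2" by auto
    have "0 \<le> G r / n" using Gnn[of r] assms(1) by simp
    then have "G t \<le> Suc i * (G r / n)" "Suc i * (G r / n) \<le> n * (G r / n)"
      using Suc.prems by (auto simp only: t(2) intro!: mult_right_mono)
    then have "G t \<le> Suc i * (G r / n)" "Suc i * (G r / n) \<le> G r" using n by auto
    then obtain c where c: "t \<le> c" "c \<le> r" "G c = Suc i * (G r / n)"
      using IVT'[of G t _ r] cont t continuous_on_subset[of "{s..r}" G "{t..r}"] by force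
    have "?D s c = ?D s t + ?D t c"
      using Henstock_Kurzweil_Integration.integral_combine[of s t c "\<lambda>t. g t * exp (- G t)"] int'[of s c] t c by auto
    moreover have "?D t c \<le> exp (- G t) - exp (- G c) + (G r / n)\<^sup>2"
    proof -
      have "G c - G t = G r / n"
        by (simp only: c(3) t(2) of_nat_Suc distrib_right mult_1_left add_diff_cancel_right')
      then show ?thesis using incr[of t c] t(1) c(1,2) by simp
    qed
    ultimately show ?case using t c by (intro bexI[of _ c]) (auto simp: algebra_simps)
  qed
  have bound: "?D s r \<le> 1 - exp (- G r) + (G r)\<^sup>2 / n" if n: "n > 0" for n :: nat
  proof -
    from part[OF n order_refl] n obtain t where t: "t \<in> {s..r}" "G t = G r"
      "?D s t \<le> 1 - exp (- G r) + n * (G r / n)\<^sup>2" by auto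
    have "?D s r = ?D s t + ?D t r"
      using Henstock_Kurzweil_Integration.integral_combine[of s t r "\<lambda>t. g t * exp (- G t)"] int'[of s r] t by auto
    \<comment> \<open>The last cut point may lie before \<open>r\<close>, but no depth is left beyond it, so \<open>incr\<close> gives zero.\<close>
    moreover have "?D t r \<le> 0" using incr[of t r] t by auto
    moreover have "n * (G r / n)\<^sup>2 = (G r)\<^sup>2 / n" using n by (simp add: power2_eq_square)
    ultimately show ?thesis using t by simp
  qed
  have "(\<lambda>n. 1 - exp (- G r) + (G r)\<^sup>2 / real n) \<longlonglongrightarrow> 1 - exp (- G r) + 0"
    by (intro tendsto_intros tendsto_divide_0[OF tendsto_const] filterlim_at_top_imp_at_infinity filterlim_real_sequentially)
  then have "?D s r \<le> 1 - exp (- G r)"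
    using bound by (intro LIMSEQ_le_const[of _ "1 - exp (- G r)"]) (auto intro!: exI[of _ 1])
  then show "(LBINT t:{s..r}. g t * exp (- G t)) \<le> 1 - exp (- G r)"
    using set_borel_integral_eq_integral(2)[OF int] by simp
qed

lemma nn_damped_integral_le:
  fixes g :: "real \<Rightarrow> real"
  assumes "s \<le> r" and g: "set_integrable lborel {s..r} g"
    and nonneg: "\<And>t. t \<in> {s..r} \<Longrightarrow> 0 \<le> g t"
  shows "(\<integral>\<^sup>+t. indicator {s..r} t * ennreal (g t * exp (- (LBINT u:{s..t}. g u))) \<partial>lborel)
     + ennreal (exp (- (LBINT u:{s..r}. g u))) \<le> 1"
proof -
  note D = damped_integral_le[OF assms(1,2) nonneg]
  have "(\<integral>\<^sup>+t. indicator {s..r} t * ennreal (g t * exp (- (LBINT u:{s..t}. g u))) \<partial>lborel)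
    = (\<integral>\<^sup>+t. ennreal (indicator {s..r} t *\<^sub>R (g t * exp (- (LBINT u:{s..t}. g u)))) \<partial>lborel)"
    by (intro nn_integral_cong) (auto simp: indicator_def)
  also have "\<dots> = ennreal (LBINT t:{s..r}. g t * exp (- (LBINT u:{s..t}. g u)))"
    using D(1) nonneg unfolding set_integrable_def set_lebesgue_integral_def
    by (intro nn_integral_eq_integral) (auto simp: indicator_def)
  also have "\<dots> + ennreal (exp (- (LBINT u:{s..r}. g u)))
      = ennreal ((LBINT t:{s..r}. g t * exp (- (LBINT u:{s..t}. g u))) + exp (- (LBINT u:{s..r}. g u)))"
    using nonneg unfolding set_lebesgue_integral_def
    by (intro ennreal_plus[symmetric] integral_nonneg_AE) (auto simp: indicator_def)
  also have "\<dots> \<le> ennreal 1" using D(2) by (intro ennreal_leI) auto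
  finally show ?thesis by simp
qed

section \<open>Strong measurability of jointly integrable functions\<close>

text \<open>
  The class of functions on a product that are limits in the mean of functions of the first variable with
  finitely many values in \<open>L\<^sup>1\<close>. It is closed under linear combinations and dominated limits, which allows
  it to be explored with the standard induction principles for integrable functions.
\<close>

definition L1_approximable ::
    "'t measure \<Rightarrow> 'a measure \<Rightarrow> ('t \<times> 'a \<Rightarrow> real) \<Rightarrow> bool"
  where "L1_approximable N M G \<longleftrightarrow> G \<in> borel_measurable (N \<Otimes>\<^sub>M M) \<and>
    (\<forall>\<epsilon>>0. \<exists>S. simple_function N S \<and> (\<forall>t\<in>space N. integrable M (S t)) \<and>
      (\<lambda>(t, z). S t z) \<in> borel_measurable (N \<Otimes>\<^sub>M M) \<and>
      (\<integral>\<^sup>+t. \<integral>\<^sup>+z. ennreal \<bar>S t z - G (t, z)\<bar> \<partial>M \<partial>N) \<le> ennreal \<epsilon>)"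

lemma L1_approximableD:
  assumes "L1_approximable N M G" "\<epsilon> > 0"
  obtains S where "simple_function N S" "\<And>t. t \<in> space N \<Longrightarrow> integrable M (S t)"
    "(\<lambda>(t, z). S t z) \<in> borel_measurable (N \<Otimes>\<^sub>M M)"
    "(\<integral>\<^sup>+t. \<integral>\<^sup>+z. ennreal \<bar>S t z - G (t, z)\<bar> \<partial>M \<partial>N) \<le> ennreal \<epsilon>"
  using assms unfolding L1_approximable_def by blast

lemma (in pair_sigma_finite) nn_integral_triangle:
  assumes [measurable]: "f \<in> borel_measurable (M1 \<Otimes>\<^sub>M M2)" "g \<in> borel_measurable (M1 \<Otimes>\<^sub>M M2)"
    "h \<in> borel_measurable (M1 \<Otimes>\<^sub>M M2)"
    and le: "\<And>w. w \<in> space (M1 \<Otimes>\<^sub>M M2) \<Longrightarrow> \<bar>f w\<bar> \<le> \<bar>g w\<bar> + \<bar>h w\<bar>"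
  shows "(\<integral>\<^sup>+t. \<integral>\<^sup>+z. ennreal \<bar>f (t, z)\<bar> \<partial>M2 \<partial>M1) \<le>
    (\<integral>\<^sup>+t. \<integral>\<^sup>+z. ennreal \<bar>g (t, z)\<bar> \<partial>M2 \<partial>M1) + (\<integral>\<^sup>+t. \<integral>\<^sup>+z. ennreal \<bar>h (t, z)\<bar> \<partial>M2 \<partial>M1)"
proof -
  have "(\<integral>\<^sup>+w. ennreal \<bar>f w\<bar> \<partial>(M1 \<Otimes>\<^sub>M M2)) \<le> (\<integral>\<^sup>+w. ennreal \<bar>g w\<bar> + ennreal \<bar>h w\<bar> \<partial>(M1 \<Otimes>\<^sub>M M2))"
    using le by (intro nn_integral_mono) (auto simp flip: ennreal_plus intro!: ennreal_leI)
  also have "\<dots> = (\<integral>\<^sup>+w. ennreal \<bar>g w\<bar> \<partial>(M1 \<Otimes>\<^sub>M M2)) + (\<integral>\<^sup>+w. ennreal \<bar>h w\<bar> \<partial>(M1 \<Otimes>\<^sub>M M2))"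
    by (intro nn_integral_add) auto
  finally show ?thesis by (simp add: M2.nn_integral_fst[symmetric])
qed

lemma (in pair_sigma_finite) L1_approximable_lin:
  assumes f: "L1_approximable M1 M2 f" and g: "L1_approximable M1 M2 g"
  shows "L1_approximable M1 M2 (\<lambda>w. f w + c * g w)"
  unfolding L1_approximable_def
proof (intro conjI allI impI)
  have [measurable]: "f \<in> borel_measurable (M1 \<Otimes>\<^sub>M M2)" "g \<in> borel_measurable (M1 \<Otimes>\<^sub>M M2)"
    using f g unfolding L1_approximable_def by auto
  show "(\<lambda>w. f w + c * g w) \<in> borel_measurable (M1 \<Otimes>\<^sub>M M2)" by measurable
  fix \<epsilon> :: real assume "\<epsilon> > 0"
  define \<delta> where "\<delta> = \<epsilon> / (2 * (1 + \<bar>c\<bar>))"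
  have "\<delta> > 0" using \<open>\<epsilon> > 0\<close> by (auto simp: \<delta>_def)
  obtain S where S: "simple_function M1 S" "\<And>t. t \<in> space M1 \<Longrightarrow> integrable M2 (S t)"
    "(\<lambda>(t, z). S t z) \<in> borel_measurable (M1 \<Otimes>\<^sub>M M2)"
    "(\<integral>\<^sup>+t. \<integral>\<^sup>+z. ennreal \<bar>S t z - f (t, z)\<bar> \<partial>M2 \<partial>M1) \<le> ennreal \<delta>"
    using L1_approximableD[OF f \<open>\<delta> > 0\<close>] by blast
  obtain T where T: "simple_function M1 T" "\<And>t. t \<in> space M1 \<Longrightarrow> integrable M2 (T t)"
    "(\<lambda>(t, z). T t z) \<in> borel_measurable (M1 \<Otimes>\<^sub>M M2)"
    "(\<integral>\<^sup>+t. \<integral>\<^sup>+z. ennreal \<bar>T t z - g (t, z)\<bar> \<partial>M2 \<partial>M1) \<le> ennreal \<delta>"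
    using L1_approximableD[OF g \<open>\<delta> > 0\<close>] by blast
  note [measurable] = S(3) T(3)
  let ?R = "\<lambda>t z. S t z + c * T t z"
  have "(\<integral>\<^sup>+t. \<integral>\<^sup>+z. ennreal \<bar>?R t z - (f (t, z) + c * g (t, z))\<bar> \<partial>M2 \<partial>M1) \<le>
     (\<integral>\<^sup>+t. \<integral>\<^sup>+z. ennreal \<bar>S t z - f (t, z)\<bar> \<partial>M2 \<partial>M1) +
     (\<integral>\<^sup>+t. \<integral>\<^sup>+z. ennreal \<bar>c * (T t z - g (t, z))\<bar> \<partial>M2 \<partial>M1)"
    using nn_integral_triangle[of "\<lambda>(t,z). ?R t z - (f (t, z) + c * g (t, z))"
        "\<lambda>(t,z). S t z - f (t, z)" "\<lambda>(t,z). c * (T t z - g (t, z))"]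
    by (auto simp: algebra_simps intro: order_trans[OF _ abs_triangle_ineq])
  also have "(\<integral>\<^sup>+t. \<integral>\<^sup>+z. ennreal \<bar>c * (T t z - g (t, z))\<bar> \<partial>M2 \<partial>M1) =
     ennreal \<bar>c\<bar> * (\<integral>\<^sup>+t. \<integral>\<^sup>+z. ennreal \<bar>T t z - g (t, z)\<bar> \<partial>M2 \<partial>M1)"
    by (simp add: abs_mult ennreal_mult nn_integral_cmult cong: nn_integral_cong)
  also have "(\<integral>\<^sup>+t. \<integral>\<^sup>+z. ennreal \<bar>S t z - f (t, z)\<bar> \<partial>M2 \<partial>M1) + \<dots> \<le> ennreal \<delta> + ennreal \<bar>c\<bar> * ennreal \<delta>"
    using S(4) T(4) by (intro add_mono mult_left_mono) auto
  also have "\<dots> = ennreal (\<delta> * (1 + \<bar>c\<bar>))"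
    using \<open>\<delta> > 0\<close> by (simp add: ennreal_mult[symmetric] ennreal_plus[symmetric] algebra_simps del: ennreal_plus)
  also have "\<dots> \<le> ennreal \<epsilon>" using \<open>\<epsilon> > 0\<close> unfolding \<delta>_def by (intro ennreal_leI) (auto simp: field_simps)
  finally have le: "(\<integral>\<^sup>+t. \<integral>\<^sup>+z. ennreal \<bar>?R t z - (f (t, z) + c * g (t, z))\<bar> \<partial>M2 \<partial>M1) \<le> ennreal \<epsilon>" .
  have "simple_function M1 ?R"
    using simple_function_compose2[OF S(1) T(1), of "\<lambda>u w z. u z + c * w z"] .
  moreover have "integrable M2 (?R t)" if "t \<in> space M1" for t
    using S(2) T(2) that by auto
  moreover have "(\<lambda>(t, z). ?R t z) \<in> borel_measurable (M1 \<Otimes>\<^sub>M M2)" by measurable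
  ultimately show "\<exists>S. simple_function M1 S \<and> (\<forall>t\<in>space M1. integrable M2 (S t)) \<and>
      (\<lambda>(t, z). S t z) \<in> borel_measurable (M1 \<Otimes>\<^sub>M M2) \<and>
      (\<integral>\<^sup>+t. \<integral>\<^sup>+z. ennreal \<bar>S t z - (f (t, z) + c * g (t, z))\<bar> \<partial>M2 \<partial>M1) \<le> ennreal \<epsilon>"
    using le by blast
qed

lemma (in pair_sigma_finite) L1_approximable_dominated:
  assumes s: "\<And>i. L1_approximable M1 M2 (s i)"
    and h: "integrable (M1 \<Otimes>\<^sub>M M2) h"
    and dom: "\<And>i w. w \<in> space (M1 \<Otimes>\<^sub>M M2) \<Longrightarrow> \<bar>s i w\<bar> \<le> h w"
    and lim: "\<And>w. w \<in> space (M1 \<Otimes>\<^sub>M M2) \<Longrightarrow> (\<lambda>i. s i w) \<longlonglongrightarrow> f w"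
  shows "L1_approximable M1 M2 f"
  unfolding L1_approximable_def
proof (intro conjI allI impI)
  have [measurable]: "s i \<in> borel_measurable (M1 \<Otimes>\<^sub>M M2)" for i
    using s unfolding L1_approximable_def by auto
  show f[measurable]: "f \<in> borel_measurable (M1 \<Otimes>\<^sub>M M2)"
    by (rule borel_measurable_LIMSEQ_real[OF lim]) auto
  fix \<epsilon> :: real assume "\<epsilon> > 0"
  have "(\<lambda>i. \<integral>w. \<bar>s i w - f w\<bar> \<partial>(M1 \<Otimes>\<^sub>M M2)) \<longlonglongrightarrow> (\<integral>w. 0 \<partial>(M1 \<Otimes>\<^sub>M M2))"
    and int: "\<And>i. integrable (M1 \<Otimes>\<^sub>M M2) (\<lambda>w. \<bar>s i w - f w\<bar>)"
  proof -
    have f_le: "\<bar>f w\<bar> \<le> h w" if "w \<in> space (M1 \<Otimes>\<^sub>M M2)" for w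
      using tendsto_rabs[OF lim[OF that]] dom[OF that] by (intro LIMSEQ_le_const2) auto
    have hyp: "(AE w in M1 \<Otimes>\<^sub>M M2. (\<lambda>i. \<bar>s i w - f w\<bar>) \<longlonglongrightarrow> 0)"
      "AE w in M1 \<Otimes>\<^sub>M M2. norm \<bar>s i w - f w\<bar> \<le> 2 * h w" for i
    proof -
      show "(AE w in M1 \<Otimes>\<^sub>M M2. (\<lambda>i. \<bar>s i w - f w\<bar>) \<longlonglongrightarrow> 0)"
        using lim by (intro AE_I2 tendsto_rabs_zero) (simp add: LIM_zero)
      show "AE w in M1 \<Otimes>\<^sub>M M2. norm \<bar>s i w - f w\<bar> \<le> 2 * h w"
      proof (rule AE_I2)
        fix w assume "w \<in> space (M1 \<Otimes>\<^sub>M M2)"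
        then show "norm \<bar>s i w - f w\<bar> \<le> 2 * h w" using dom[of w i] f_le[of w] by auto
      qed
    qed
    have 2: "integrable (M1 \<Otimes>\<^sub>M M2) (\<lambda>w. 2 * h w)" using h by simp
    show "(\<lambda>i. \<integral>w. \<bar>s i w - f w\<bar> \<partial>(M1 \<Otimes>\<^sub>M M2)) \<longlonglongrightarrow> (\<integral>w. 0 \<partial>(M1 \<Otimes>\<^sub>M M2))"
      by (rule integral_dominated_convergence[OF _ _ 2 hyp]) auto
    show "integrable (M1 \<Otimes>\<^sub>M M2) (\<lambda>w. \<bar>s i w - f w\<bar>)" for i
      by (rule Bochner_Integration.integrable_bound[OF 2]) (use hyp(2)[of i] in auto)
  qed
  then have "\<forall>\<^sub>F i in sequentially. (\<integral>w. \<bar>s i w - f w\<bar> \<partial>(M1 \<Otimes>\<^sub>M M2)) < \<epsilon> / 2"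
    using \<open>\<epsilon> > 0\<close> by (intro order_tendstoD) auto
  then obtain i where i: "(\<integral>w. \<bar>s i w - f w\<bar> \<partial>(M1 \<Otimes>\<^sub>M M2)) < \<epsilon> / 2"
    by (auto simp: eventually_sequentially)
  have "(\<integral>\<^sup>+t. \<integral>\<^sup>+z. ennreal \<bar>s i (t, z) - f (t, z)\<bar> \<partial>M2 \<partial>M1) = (\<integral>\<^sup>+w. ennreal \<bar>s i w - f w\<bar> \<partial>(M1 \<Otimes>\<^sub>M M2))"
    by (subst M2.nn_integral_fst[symmetric]) auto
  also have "\<dots> = ennreal (\<integral>w. \<bar>s i w - f w\<bar> \<partial>(M1 \<Otimes>\<^sub>M M2))"
    by (intro nn_integral_eq_integral int) auto
  also have "\<dots> \<le> ennreal (\<epsilon> / 2)" using i by (intro ennreal_leI) auto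
  finally have 1: "(\<integral>\<^sup>+t. \<integral>\<^sup>+z. ennreal \<bar>s i (t, z) - f (t, z)\<bar> \<partial>M2 \<partial>M1) \<le> ennreal (\<epsilon> / 2)" .
  have "\<epsilon> / 2 > 0" using \<open>\<epsilon> > 0\<close> by simp
  then obtain S where S: "simple_function M1 S" "\<And>t. t \<in> space M1 \<Longrightarrow> integrable M2 (S t)"
    "(\<lambda>(t, z). S t z) \<in> borel_measurable (M1 \<Otimes>\<^sub>M M2)"
    "(\<integral>\<^sup>+t. \<integral>\<^sup>+z. ennreal \<bar>S t z - s i (t, z)\<bar> \<partial>M2 \<partial>M1) \<le> ennreal (\<epsilon> / 2)"
    using L1_approximableD[OF s[of i]] by blast
  note [measurable] = S(3)
  have "(\<integral>\<^sup>+t. \<integral>\<^sup>+z. ennreal \<bar>S t z - f (t, z)\<bar> \<partial>M2 \<partial>M1) \<le>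
     (\<integral>\<^sup>+t. \<integral>\<^sup>+z. ennreal \<bar>S t z - s i (t, z)\<bar> \<partial>M2 \<partial>M1) +
     (\<integral>\<^sup>+t. \<integral>\<^sup>+z. ennreal \<bar>s i (t, z) - f (t, z)\<bar> \<partial>M2 \<partial>M1)"
    using nn_integral_triangle[of "\<lambda>(t,z). S t z - f (t, z)"
        "\<lambda>(t,z). S t z - s i (t, z)" "\<lambda>(t,z). s i (t, z) - f (t, z)"] by auto
  also have "\<dots> \<le> ennreal (\<epsilon> / 2) + ennreal (\<epsilon> / 2)" using S(4) 1 by (rule add_mono)
  also have "\<dots> = ennreal \<epsilon>" using \<open>\<epsilon> > 0\<close> by (simp flip: ennreal_plus)
  finally show "\<exists>S. simple_function M1 S \<and> (\<forall>t\<in>space M1. integrable M2 (S t)) \<and>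
      (\<lambda>(t, z). S t z) \<in> borel_measurable (M1 \<Otimes>\<^sub>M M2) \<and>
      (\<integral>\<^sup>+t. \<integral>\<^sup>+z. ennreal \<bar>S t z - f (t, z)\<bar> \<partial>M2 \<partial>M1) \<le> ennreal \<epsilon>"
    using S by blast
qed

lemma (in pair_sigma_finite) L1_approximable_rectangle:
  assumes [measurable]: "A \<in> sets M1" "B \<in> sets M2" and fin: "emeasure M2 B < \<infinity>"
  shows "L1_approximable M1 M2 (indicator (A \<times> B))"
  unfolding L1_approximable_def
proof (intro conjI allI impI exI)
  let ?S = "\<lambda>t. if t \<in> A then indicat_real B else (\<lambda>z. 0)"
  show "indicat_real (A \<times> B) \<in> borel_measurable (M1 \<Otimes>\<^sub>M M2)" by measurable
  show "simple_function M1 ?S"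
    by (intro simple_function_If_set) auto
  show "\<forall>t\<in>space M1. integrable M2 (?S t)"
    using fin by (auto simp: integrable_indicator_iff)
  have "(\<lambda>(t, z). ?S t z) = indicat_real (A \<times> B)" by (auto simp: indicator_def)
  then show "(\<lambda>(t, z). ?S t z) \<in> borel_measurable (M1 \<Otimes>\<^sub>M M2)" by simp
  have "?S t z - indicator (A \<times> B) (t, z) = 0" for t z by (auto simp: indicator_def)
  then show "(\<integral>\<^sup>+t. \<integral>\<^sup>+z. ennreal \<bar>?S t z - indicator (A \<times> B) (t, z)\<bar> \<partial>M2 \<partial>M1) \<le> ennreal \<epsilon>" for \<epsilon>
    by simp
qed

lemma (in pair_sigma_finite) L1_approximable_zero: "L1_approximable M1 M2 (\<lambda>w. 0)"
  using L1_approximable_rectangle[of "{}" "{}"] by (simp add: indicator_def[abs_def])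

text \<open>
  Rectangles \<open>A \<times> B\<close> are approximated by themselves, as they are the step function with the values
  \<open>indicator B\<close> and \<open>0\<close>. Inside a box of finite measure the sets with approximable indicator form a Dynkin
  system, so they comprise all measurable sets; by \<open>\<sigma>\<close>-finiteness, boxes exhaust the space. The step from
  indicators to integrable functions is linearity and dominated convergence.
\<close>

lemma (in pair_sigma_finite) L1_approximable_integrable:
  assumes "integrable (M1 \<Otimes>\<^sub>M M2) G"
  shows "L1_approximable M1 M2 G"
proof -
  have boxed: "L1_approximable M1 M2 (indicator (C \<inter> A \<times> B))"
    if [measurable]: "A \<in> sets M1" "B \<in> sets M2" and fin: "emeasure M1 A < \<infinity>" "emeasure M2 B < \<infinity>"
      and C: "C \<in> sets (M1 \<Otimes>\<^sub>M M2)" for A B C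
    using Int_stable_pair_measure_generator pair_measure_closed C[unfolded sets_pair_measure]
  proof (induction C rule: sigma_sets_induct_disjoint)
    case (basic C)
    then obtain a c where C: "C = a \<times> c" and [measurable]: "a \<in> sets M1" "c \<in> sets M2" by auto
    have "emeasure M2 (c \<inter> B) < \<infinity>"
      using emeasure_mono[of "c \<inter> B" B M2] fin by (auto simp: less_top[symmetric] top_unique)
    then show ?case
      using L1_approximable_rectangle[of "a \<inter> A" "c \<inter> B"] unfolding C by (simp add: Times_Int_Times)
  next
    case empty
    show ?case using L1_approximable_zero by simp
  next
    case (compl C)
    have "indicat_real ((space M1 \<times> space M2 - C) \<inter> A \<times> B)
      = (\<lambda>w. indicator (A \<times> B) w + (- 1) * indicator (C \<inter> A \<times> B) w)"
      using sets.sets_into_space[OF that(1)] sets.sets_into_space[OF that(2)]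
      by (auto simp: indicator_def fun_eq_iff)
    then show ?case
      using L1_approximable_lin[OF L1_approximable_rectangle[OF that(1,2) fin(2)] compl(2), of "- 1"] by simp
  next
    case (union C)
    define s where "s n w = (\<Sum>i<n. indicat_real (C i \<inter> A \<times> B) w)" for n w
    have s_eq: "s n w = indicat_real ((\<Union>i<n. C i) \<inter> A \<times> B) w" for n w
    proof -
      have "indicator (\<Union>i<n. C i \<inter> A \<times> B) w = (\<Sum>i<n. indicat_real (C i \<inter> A \<times> B) w)"
        by (rule indicator_UN_disjoint)
          (use union(1) in \<open>auto simp: disjoint_family_on_def\<close>)
      moreover have "(\<Union>i<n. C i \<inter> A \<times> B) = (\<Union>i<n. C i) \<inter> A \<times> B" by auto
      ultimately show ?thesis by (simp add: s_def)
    qed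
    show ?case
    proof (rule L1_approximable_dominated[of s "indicator (A \<times> B)"])
      show "L1_approximable M1 M2 (s n)" for n
      proof (induction n)
        case 0
        show ?case using L1_approximable_zero by (simp add: s_def[abs_def])
      next
        case (Suc n)
        show ?case using L1_approximable_lin[OF Suc union(3)[of n], of 1] by (simp add: s_def[abs_def])
      qed
      show "integrable (M1 \<Otimes>\<^sub>M M2) (indicat_real (A \<times> B))"
        using fin by (auto simp: integrable_indicator_iff M2.emeasure_pair_measure_Times ennreal_mult_less_top)
      show "\<bar>s i w\<bar> \<le> indicator (A \<times> B) w" for i w
        unfolding s_eq by (auto simp: indicator_def)
      show "(\<lambda>i. s i w) \<longlonglongrightarrow> indicator (\<Union> (range C) \<inter> A \<times> B) w" for w
      proof -
        have "(\<lambda>i. indicat_real ((\<Union>j<i. C j \<inter> A \<times> B)) w) \<longlonglongrightarrow> indicator (\<Union>j. C j \<inter> A \<times> B) w"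
          by (rule LIMSEQ_indicator_UN)
        moreover have "(\<Union>j<i. C j \<inter> A \<times> B) = (\<Union>j<i. C j) \<inter> A \<times> B" for i by auto
        moreover have "(\<Union>j. C j \<inter> A \<times> B) = \<Union> (range C) \<inter> A \<times> B" by auto
        ultimately show ?thesis unfolding s_eq by simp
      qed
    qed
  qed
  show ?thesis
    using assms
  proof (induction rule: integrable_induct)
    case (base C c)
    obtain A where A: "range A \<subseteq> sets M1" "(\<Union>i. A i) = space M1" "\<And>i. emeasure M1 (A i) \<noteq> \<infinity>" "incseq A"
      using M1.sigma_finite_incseq by blast
    obtain B where B: "range B \<subseteq> sets M2" "(\<Union>i. B i) = space M2" "\<And>i. emeasure M2 (B i) \<noteq> \<infinity>" "incseq B"
      using M2.sigma_finite_incseq by blast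
    have "L1_approximable M1 M2 (indicator C)"
    proof (rule L1_approximable_dominated[of "\<lambda>i. indicator (C \<inter> A i \<times> B i)" "indicator C"])
      show "L1_approximable M1 M2 (indicator (C \<inter> A i \<times> B i))" for i
        using A B base by (intro boxed) (auto simp: less_top)
      show "integrable (M1 \<Otimes>\<^sub>M M2) (indicat_real C)" using base by (simp add: integrable_indicator_iff)
      show "\<bar>indicat_real (C \<inter> A i \<times> B i) w\<bar> \<le> indicator C w" for i w by (auto simp: indicator_def)
      fix w assume w: "w \<in> space (M1 \<Otimes>\<^sub>M M2)"
      have "incseq (\<lambda>i. C \<inter> A i \<times> B i)"
        using A(4) B(4) unfolding incseq_def by fast
      then have "(\<lambda>i. indicat_real (C \<inter> A i \<times> B i) w) \<longlonglongrightarrow> indicator (\<Union>i. C \<inter> A i \<times> B i) w"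
        by (rule LIMSEQ_indicator_incseq)
      moreover have "w \<in> (\<Union>i. C \<inter> A i \<times> B i) \<longleftrightarrow> w \<in> C"
      proof -
        have "fst w \<in> (\<Union>i. A i)" "snd w \<in> (\<Union>i. B i)"
          using w unfolding A(2) B(2) by (auto simp: space_pair_measure)
        then obtain i j where ij: "fst w \<in> A i" "snd w \<in> B j" by blast
        then have "fst w \<in> A (max i j)" "snd w \<in> B (max i j)"
          using A(4) B(4) incseqD[of A i "max i j"] incseqD[of B j "max i j"] by auto
        then show ?thesis by (auto simp: mem_Times_iff)
      qed
      ultimately show "(\<lambda>i. indicat_real (C \<inter> A i \<times> B i) w) \<longlonglongrightarrow> indicator C w"
        by (simp add: indicator_def cong: if_cong)
    qed
    then show ?case
      using L1_approximable_lin[OF L1_approximable_zero, of "indicator C" c] by (simp add: mult.commute)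
  next
    case (add f g)
    then show ?case using L1_approximable_lin[of f g 1] by simp
  next
    case (lim f s)
    show ?case
      by (rule L1_approximable_dominated[of s "\<lambda>w. 2 * \<bar>f w\<bar>"]) (use lim in auto)
  qed
qed

text \<open>
  Approximants with errors \<open>2\<^sup>-\<^sup>n\<close> in the mean have a summable error. Exchanging sum and integral, the sum of
  \<open>L\<^sup>1\<close> distances is finite at almost every point, so its terms tend to zero there.
\<close>

lemma (in pair_sigma_finite) integrable_imp_L1_strongly_measurable:
  assumes G: "integrable (M1 \<Otimes>\<^sub>M M2) G"
  shows "L1_strongly_measurable M1 M2 (\<lambda>t z. G (t, z))"
proof -
  have [measurable]: "G \<in> borel_measurable (M1 \<Otimes>\<^sub>M M2)" using G by auto
  define P where "P n S \<longleftrightarrow> simple_function M1 S \<and> (\<forall>t\<in>space M1. integrable M2 (S t)) \<and>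
      (\<lambda>(t, z). S t z) \<in> borel_measurable (M1 \<Otimes>\<^sub>M M2) \<and>
      (\<integral>\<^sup>+t. \<integral>\<^sup>+z. ennreal \<bar>S t z - G (t, z)\<bar> \<partial>M2 \<partial>M1) \<le> ennreal ((1 / 2) ^ n)" for S and n :: nat
  have "\<forall>n. \<exists>S. P n S"
    using L1_approximable_integrable[OF G] unfolding L1_approximable_def P_def by simp
  then obtain S where "\<forall>n. P n (S n)" by (rule choice[THEN exE])
  then have S: "simple_function M1 (S n)" "t \<in> space M1 \<Longrightarrow> integrable M2 (S n t)"
    and [measurable]: "(\<lambda>(t, z). S n t z) \<in> borel_measurable (M1 \<Otimes>\<^sub>M M2)"
    and S_le: "(\<integral>\<^sup>+t. \<integral>\<^sup>+z. ennreal \<bar>S n t z - G (t, z)\<bar> \<partial>M2 \<partial>M1) \<le> ennreal ((1 / 2) ^ n)" for n t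
    unfolding P_def by auto
  define e where "e n t = (\<integral>\<^sup>+z. ennreal \<bar>S n t z - G (t, z)\<bar> \<partial>M2)" for n t
  have [measurable]: "e n \<in> borel_measurable M1" for n unfolding e_def by measurable
  have "(\<integral>\<^sup>+t. (\<Sum>n. e n t) \<partial>M1) = (\<Sum>n. \<integral>\<^sup>+t. e n t \<partial>M1)"
    by (rule nn_integral_suminf) auto
  also have "\<dots> \<le> (\<Sum>n. ennreal ((1 / 2) ^ n))"
    using S_le unfolding e_def by (intro suminf_le) auto
  also have "\<dots> < \<infinity>"
    by (subst suminf_ennreal2) (auto intro: summable_geometric)
  finally have "(\<integral>\<^sup>+t. (\<Sum>n. e n t) \<partial>M1) \<noteq> \<infinity>" by simp
  then have ae: "AE t in M1. (\<Sum>n. e n t) \<noteq> \<infinity>"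
    by (intro nn_integral_PInf_AE) auto
  have "AE t in M1. integrable M2 (\<lambda>z. G (t, z))"
    using AE_integrable_fst'[OF G] .
  with ae AE_space have "AE t in M1. (\<lambda>z. G (t, z)) \<in> L1_space M2 \<and>
      (\<lambda>n. L1_norm M2 (\<lambda>z. S n t z - G (t, z))) \<longlonglongrightarrow> 0"
  proof eventually_elim
    case (elim t)
    have e_eq: "e n t = ennreal (L1_norm M2 (\<lambda>z. S n t z - G (t, z)))" for n
      unfolding e_def L1_norm_def using S(2)[of t n] elim by (intro nn_integral_eq_integral) auto
    have "summable (\<lambda>n. L1_norm M2 (\<lambda>z. S n t z - G (t, z)))"
      using elim(1) unfolding e_eq by (intro summable_suminf_not_top) (auto simp: L1_norm_def)
    then show ?case
      using elim(3) by (auto simp: L1_space_def intro: summable_LIMSEQ_zero)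
  qed
  then show ?thesis
    unfolding L1_strongly_measurable_def using S by (intro exI[of _ S]) (auto simp: L1_space_def)
qed

section \<open>Trajectories that stay inside the domain\<close>

text \<open>
  The condition \<open>h < \<tau>(x, v)\<close> expressed through the segment from \<open>x\<close> back to \<open>x - h v\<close>. Scaling the parameter
  of the segment to a fixed compact interval makes the set of all such \<open>(h, x, v)\<close> open, from which joint
  measurability follows without any discussion of the infimum that defines \<open>\<tau>\<close>.
\<close>

definition clear_paths :: "'a::euclidean_space set \<Rightarrow> (real \<times> 'a \<times> 'a) set"
  where "clear_paths \<Omega> = {(h, x, v). \<forall>q\<in>{0..1}. x - (q * h) *\<^sub>R v \<in> \<Omega>}"

text \<open>
  The complement is the projection of a closed set along the compact factor \<open>{0..1}\<close>.
\<close>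

lemma open_clear_paths:
  fixes \<Omega> :: "'a::euclidean_space set"
  assumes "open \<Omega>"
  shows "open (clear_paths \<Omega>)"
proof -
  let ?T = "{w :: real \<times> real \<times> 'a \<times> 'a. fst (snd (snd w)) - (fst w * fst (snd w)) *\<^sub>R snd (snd (snd w)) \<in> - \<Omega>}"
  have "closed ((\<lambda>w :: real \<times> real \<times> 'a \<times> 'a.
      fst (snd (snd w)) - (fst w * fst (snd w)) *\<^sub>R snd (snd (snd w))) -` (- \<Omega>))"
    using assms by (intro closed_vimage continuous_intros) auto
  then have "closed ?T" by (simp only: vimage_def)
  have "closed {y. \<exists>q. q \<in> {0..1} \<and> (q, y) \<in> ?T}"
    by (rule closed_compact_projection[OF _ \<open>closed ?T\<close>]) simp
  moreover have "{y. \<exists>q. q \<in> {0..1} \<and> (q, y) \<in> ?T} = - clear_paths \<Omega>"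
    by (auto simp: clear_paths_def)
  ultimately show ?thesis by (simp add: closed_def)
qed

text \<open>
  That the infimum is strictly above \<open>h\<close> comes from the openness of \<open>\<Omega>\<close>: a trajectory that is inside at
  time \<open>h\<close> stays inside for a little longer.
\<close>

lemma less_exit_time_iff:
  assumes "open \<Omega>" "x \<in> \<Omega>" "0 \<le> h"
  shows "ereal h < exit_time \<Omega> x v \<longleftrightarrow> (h, x, v) \<in> clear_paths \<Omega>"
proof
  assume less: "ereal h < exit_time \<Omega> x v"
  have "x - (q * h) *\<^sub>R v \<in> \<Omega>" if "q \<in> {0..1}" for q
  proof (rule ccontr)
    assume out: "x - (q * h) *\<^sub>R v \<notin> \<Omega>"
    then have "q * h \<noteq> 0" using assms(2) by (intro notI) simp
    then have "0 < q * h" using that assms(3) by (simp add: less_le)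
    then have "exit_time \<Omega> x v \<le> ereal (q * h)"
      unfolding exit_time_def using out by (intro INF_lower) auto
    also have "\<dots> \<le> ereal h" using that assms(3) by (simp add: mult_left_le_one_le)
    finally show False using less by simp
  qed
  then show "(h, x, v) \<in> clear_paths \<Omega>" by (simp add: clear_paths_def)
next
  assume "(h, x, v) \<in> clear_paths \<Omega>"
  then have path: "x - (q * h) *\<^sub>R v \<in> \<Omega>" if "q \<in> {0..1}" for q
    using that by (auto simp: clear_paths_def)
  have "open ((\<lambda>t. x - t *\<^sub>R v) -` \<Omega>)"
    by (intro open_vimage assms continuous_intros)
  moreover have "h \<in> (\<lambda>t. x - t *\<^sub>R v) -` \<Omega>" using path[of 1] by simp
  ultimately obtain e where e: "e > 0" "\<And>t. dist t h < e \<Longrightarrow> x - t *\<^sub>R v \<in> \<Omega>"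
    unfolding open_dist by blast
  have "ereal (h + e) \<le> exit_time \<Omega> x v"
    unfolding exit_time_def
  proof (rule INF_greatest)
    fix t assume t: "t \<in> {t. 0 < t \<and> x - t *\<^sub>R v \<notin> \<Omega>}"
    have "h < t"
    proof (rule ccontr)
      assume "\<not> h < t"
      then show False using path[of "t / h"] t by (auto simp: field_simps)
    qed
    then show "ereal (h + e) \<le> ereal t" using e(2)[of t] t by (force simp: dist_real_def)
  qed
  moreover have "ereal h < ereal (h + e)" using e by simp
  ultimately show "ereal h < exit_time \<Omega> x v" by (rule less_le_trans[rotated])
qed

section \<open>Measure-theoretic preliminaries\<close>

lemma zero_extension_measurable:
  fixes f :: "'a \<times> 'b \<Rightarrow> real"
  assumes f: "f \<in> borel_measurable (restrict_space M S \<Otimes>\<^sub>M N)" and S: "S \<in> sets M"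
  shows "(\<lambda>(x, y). if x \<in> S then f (x, y) else 0) \<in> borel_measurable (M \<Otimes>\<^sub>M N)"
proof -
  let ?R = "restrict_space (M \<Otimes>\<^sub>M N) {w. fst w \<in> S}"
  have pred: "{w \<in> space (M \<Otimes>\<^sub>M N). fst w \<in> S} \<in> sets (M \<Otimes>\<^sub>M N)"
    using S by measurable
  have "fst \<in> ?R \<rightarrow>\<^sub>M restrict_space M S"
    by (intro measurable_restrict_space2 measurable_restrict_space1 measurable_fst) (auto simp: space_restrict_space)
  moreover have "snd \<in> ?R \<rightarrow>\<^sub>M N"
    by (intro measurable_restrict_space1 measurable_snd)
  ultimately have "(\<lambda>w. (fst w, snd w)) \<in> ?R \<rightarrow>\<^sub>M restrict_space M S \<Otimes>\<^sub>M N"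
    by (rule measurable_Pair)
  then have "(\<lambda>w. f (fst w, snd w)) \<in> borel_measurable ?R"
    using f by (rule measurable_compose)
  then have "(\<lambda>w. if fst w \<in> S then f (fst w, snd w) else 0) \<in> borel_measurable (M \<Otimes>\<^sub>M N)"
    using pred by (subst measurable_If_restrict_space_iff) auto
  then show ?thesis by (simp add: case_prod_beta')
qed

lemma nn_integral_lborel_translate:
  fixes c :: "'a::euclidean_space"
  assumes [measurable]: "g \<in> borel_measurable borel"
  shows "(\<integral>\<^sup>+x. g x \<partial>lborel) = (\<integral>\<^sup>+x. g (c + x) \<partial>lborel)"
proof -
  have "(\<integral>\<^sup>+x. g x \<partial>lborel) = (\<integral>\<^sup>+x. g x \<partial>distr lborel borel ((+) c))"
    by (simp add: lborel_distr_plus)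
  then show ?thesis by (simp add: nn_integral_distr)
qed

lemma space_half_line [simp]: "space (half_line s) = {s..}"
  by (simp add: half_line_def space_restrict_space)

interpretation half_line: sigma_finite_measure "half_line s" for s
  unfolding half_line_def by (rule sigma_finite_measure_restrict_space) (auto intro: sigma_finite_lborel)

lemma half_line_id_measurable: "0 \<le> s \<Longrightarrow> (\<lambda>t. t) \<in> half_line s \<rightarrow>\<^sub>M half_line 0"
  unfolding half_line_def
  by (intro measurable_restrict_space2 measurable_restrict_space1) (auto simp: space_restrict_space)

lemma half_line_borel: "(\<lambda>t. t) \<in> borel_measurable (half_line s)"
  unfolding half_line_def by (intro measurable_restrict_space1) auto

lemma nn_integral_half_line: "(\<integral>\<^sup>+t. g t \<partial>half_line s) = (\<integral>\<^sup>+t. g t * indicator {s..} t \<partial>lborel)"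
  unfolding half_line_def by (intro nn_integral_restrict_space) auto

lemma AE_half_line: "(AE t in half_line s. Q t) \<longleftrightarrow> (AE t in lborel. s \<le> t \<longrightarrow> Q t)"
  unfolding half_line_def by (subst AE_restrict_space_iff) auto

lemma closed_measure_support:
  fixes \<mu> :: "'a::topological_space measure"
  shows "closed (measure_support \<mu>)"
proof -
  have "- measure_support \<mu> = \<Union> {W. open W \<and> emeasure \<mu> W = 0}"
    by (auto simp: measure_support_def zero_less_iff_neq_zero)
  then show ?thesis unfolding closed_def by auto
qed

text \<open>
  Monotone convergence along the final times \<open>s + n\<close>.
\<close>

lemma nn_integral_half_line_le:
  assumes [measurable]: "g \<in> borel_measurable (half_line s)"
    and bound: "\<And>r. s \<le> r \<Longrightarrow> (\<integral>\<^sup>+t. indicator {..r} t * g t \<partial>half_line s) \<le> C"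
  shows "(\<integral>\<^sup>+t. g t \<partial>half_line s) \<le> C"
proof -
  let ?g = "\<lambda>n t. indicator {..s + real n} t * g t"
  have [measurable]: "?g n \<in> borel_measurable (half_line s)" for n
  proof -
    have "(\<lambda>t. indicator {..s + real n} t :: ennreal) \<in> borel_measurable (half_line s)"
      by (rule measurable_compose[OF half_line_borel]) simp
    then show ?thesis by measurable
  qed
  have "g t \<le> (SUP n. ?g n t)" for t
  proof -
    obtain n where "t - s \<le> real n" using real_arch_simple by blast
    then have "g t = ?g n t" by (auto simp: indicator_def)
    then show ?thesis by (rule ord_eq_le_trans) (rule SUP_upper, simp)
  qed
  then have "(\<integral>\<^sup>+t. g t \<partial>half_line s) \<le> (\<integral>\<^sup>+t. (SUP n. ?g n t) \<partial>half_line s)"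
    by (intro nn_integral_mono)
  also have "\<dots> = (SUP n. \<integral>\<^sup>+t. ?g n t \<partial>half_line s)"
  proof (rule nn_integral_monotone_convergence_SUP)
    show "incseq ?g"
      by (auto simp: incseq_def le_fun_def indicator_def)
  qed measurable
  also have "\<dots> \<le> C" using bound by (intro SUP_least) auto
  finally show ?thesis .
qed

text \<open>
  Without integrability the left-hand side is zero, which is the convention that applies to the collision
  operator at exceptional points.
\<close>

lemma ennreal_abs_integral_le:
  fixes f :: "'a \<Rightarrow> real"
  shows "ennreal \<bar>\<integral>x. f x \<partial>M\<bar> \<le> (\<integral>\<^sup>+x. ennreal \<bar>f x\<bar> \<partial>M)"
  using integral_norm_bound_ennreal[of M f] by (cases "integrable M f") (auto simp: not_integrable_integral_eq)

lemma ennreal_L1_norm: "integrable M \<phi> \<Longrightarrow> ennreal (L1_norm M \<phi>) = (\<integral>\<^sup>+z. ennreal \<bar>\<phi> z\<bar> \<partial>M)"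
  unfolding L1_norm_def by (intro nn_integral_eq_integral[symmetric]) auto

section \<open>The transport operators\<close>

text \<open>
  The data of the linear transport equation; \<open>subcritical\<close> says that collisions create no more particles
  than they remove.
\<close>

locale collision_transport =
  fixes \<Omega> :: "'a::euclidean_space set"
    and \<mu> :: "'a measure"
    and \<Sigma> :: "real \<Rightarrow> 'a \<Rightarrow> real"
    and b :: "real \<Rightarrow> 'a \<Rightarrow> 'a \<Rightarrow> real"
  assumes open_domain: "open \<Omega>"
    and sets_\<mu>: "sets \<mu> = sets borel"
    and sigma_finite_\<mu>: "sigma_finite_measure \<mu>"
    and \<Sigma>_measurable: "(\<lambda>(t, v). \<Sigma> t v) \<in> borel_measurable (half_line 0 \<Otimes>\<^sub>M velocity_measure \<mu>)"
    and \<Sigma>_nonneg: "\<And>t v. 0 \<le> t \<Longrightarrow> v \<in> measure_support \<mu> \<Longrightarrow> 0 \<le> \<Sigma> t v"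
    and \<Sigma>_integrable: "AE v in velocity_measure \<mu>. \<forall>T\<ge>0. set_integrable lborel {0..T} (\<lambda>t. \<Sigma> t v)"
    and b_measurable: "(\<lambda>(t, v, v'). b t v v') \<in> borel_measurable
           (half_line 0 \<Otimes>\<^sub>M velocity_measure \<mu> \<Otimes>\<^sub>M velocity_measure \<mu>)"
    and b_nonneg: "\<And>t v v'. 0 \<le> t \<Longrightarrow> v \<in> measure_support \<mu> \<Longrightarrow> v' \<in> measure_support \<mu>
           \<Longrightarrow> 0 \<le> b t v v'"
    and subcritical: "AE (t, v') in half_line 0 \<Otimes>\<^sub>M velocity_measure \<mu>.
           (\<integral>\<^sup>+v. ennreal (b t v v') \<partial>velocity_measure \<mu>) \<le> ennreal (\<Sigma> t v')"
begin

abbreviation "N \<equiv> velocity_measure \<mu>"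
abbreviation "L \<equiv> restrict_space lborel \<Omega>"
abbreviation "P \<equiv> phase_measure \<Omega> \<mu>"

lemma space_N [simp]: "space N = measure_support \<mu>"
  using sets_eq_imp_space_eq[OF sets_\<mu>] by (simp add: velocity_measure_def space_restrict_space)

lemma P_eq: "P = L \<Otimes>\<^sub>M N"
  by (simp add: phase_measure_def)

lemma space_P: "space P = \<Omega> \<times> measure_support \<mu>"
  by (simp add: P_eq space_pair_measure space_restrict_space)

sublocale N: sigma_finite_measure N
  unfolding velocity_measure_def using sigma_finite_\<mu> closed_measure_support[of \<mu>]
  by (intro sigma_finite_measure_restrict_space) (simp_all add: sets_\<mu> borel_closed)

sublocale L: sigma_finite_measure L
  using open_domain sigma_finite_lborel by (intro sigma_finite_measure_restrict_space) auto

sublocale LN: pair_sigma_finite L N ..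

sublocale P: sigma_finite_measure P
  unfolding P_eq by (rule sigma_finite_pair_measure) unfold_locales

sublocale HP: pair_sigma_finite "half_line s" P for s ..

sublocale HN: pair_sigma_finite "half_line s" N for s ..

sublocale RN: pair_sigma_finite "lborel :: 'a measure" N ..

lemma N_borel: "(\<lambda>v. v) \<in> borel_measurable N"
  unfolding velocity_measure_def using measurable_ident_sets[OF sets_\<mu>] by (rule measurable_restrict_space1)

lemma P_ident: "(\<lambda>z. z) \<in> P \<rightarrow>\<^sub>M lborel \<Otimes>\<^sub>M N"
proof -
  have "(\<lambda>x. x) \<in> L \<rightarrow>\<^sub>M lborel" by (intro measurable_restrict_space1) simp
  then have "(\<lambda>z. (fst z, snd z)) \<in> P \<rightarrow>\<^sub>M lborel \<Otimes>\<^sub>M N"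
    unfolding P_eq by (intro measurable_Pair measurable_compose[OF measurable_fst] measurable_snd)
  then show ?thesis by simp
qed

definition attenuation :: "real \<Rightarrow> real \<Rightarrow> 'a \<Rightarrow> real"
  where "attenuation s t v = exp (- (LBINT r:{s..t}. \<Sigma> r v))"

lemma attenuation_measurable:
  assumes "0 \<le> s"
  shows "(\<lambda>(t, v). attenuation s t v) \<in> borel_measurable (half_line s \<Otimes>\<^sub>M N)"
proof -
  have "(\<lambda>w. (snd w, snd (fst w))) \<in> (half_line s \<Otimes>\<^sub>M N) \<Otimes>\<^sub>M half_line 0 \<rightarrow>\<^sub>M half_line 0 \<Otimes>\<^sub>M N"
    by measurable
  from measurable_compose[OF this \<Sigma>_measurable]
  have [measurable]: "(\<lambda>w. \<Sigma> (snd w) (snd (fst w))) \<in> borel_measurable ((half_line s \<Otimes>\<^sub>M N) \<Otimes>\<^sub>M half_line 0)"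
    by simp
  have [measurable]: "(\<lambda>w. fst (fst w)) \<in> borel_measurable ((half_line s \<Otimes>\<^sub>M N) \<Otimes>\<^sub>M half_line 0)"
    "snd \<in> borel_measurable ((half_line s \<Otimes>\<^sub>M N) \<Otimes>\<^sub>M half_line 0)"
    using measurable_compose[OF measurable_compose[OF measurable_fst measurable_fst] half_line_borel]
      measurable_compose[OF measurable_snd half_line_borel] by auto
  have "(LBINT r:{s..t}. \<Sigma> r v) = (\<integral>r. (if s \<le> r \<and> r \<le> t then \<Sigma> r v else 0) \<partial>half_line 0)" for t v
    unfolding half_line_def set_lebesgue_integral_def using assms
    by (subst integral_restrict_space) (auto intro!: Bochner_Integration.integral_cong simp: indicator_def)
  then have "(\<lambda>(t, v). attenuation s t v) =
    (\<lambda>w. exp (- (\<integral>r. (if s \<le> r \<and> r \<le> fst w then \<Sigma> r (snd w) else 0) \<partial>half_line 0)))"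
    by (simp add: attenuation_def case_prod_beta')
  also have "\<dots> \<in> borel_measurable (half_line s \<Otimes>\<^sub>M N)" by measurable
  finally show ?thesis .
qed

text \<open>
  Functions on \<open>\<Omega> \<times> V\<close> are extended by zero to all positions, so that the translation in the position
  variable can be carried out on the whole Euclidean space.
\<close>

definition zero_ext :: "('a \<times> 'a \<Rightarrow> real) \<Rightarrow> 'a \<times> 'a \<Rightarrow> real"
  where "zero_ext f = (\<lambda>(x, v). if x \<in> \<Omega> then f (x, v) else 0)"

lemma zero_ext_measurable:
  "f \<in> borel_measurable P \<Longrightarrow> zero_ext f \<in> borel_measurable (lborel \<Otimes>\<^sub>M N)"
  unfolding zero_ext_def P_eq using open_domain by (intro zero_extension_measurable) auto

text \<open>
  The indicator only survives when the foot \<open>x - (t - s) v\<close> of the characteristic lies in \<open>\<Omega>\<close>, where the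
  zero extension agrees with \<open>f\<close>.
\<close>

lemma U_op_eq:
  assumes "s \<le> t" "x \<in> \<Omega>"
  shows "U_op \<Omega> \<Sigma> t s f (x, v) =
    attenuation s t v * indicator (clear_paths \<Omega>) (t - s, x, v) * zero_ext f (x - (t - s) *\<^sub>R v, v)"
proof -
  have "x - (t - s) *\<^sub>R v \<in> \<Omega>" if "(t - s, x, v) \<in> clear_paths \<Omega>"
    using that unfolding clear_paths_def by (auto dest: bspec[of _ _ 1])
  then show ?thesis
    using less_exit_time_iff[OF open_domain assms(2), of "t - s" v] assms(1)
    by (auto simp: U_op_def attenuation_def zero_ext_def)
qed

abbreviation "K s \<equiv> half_line s \<Otimes>\<^sub>M (lborel \<Otimes>\<^sub>M N)"

lemma K_coords:
  "fst \<in> borel_measurable (K s)" "(\<lambda>w. fst (snd w)) \<in> borel_measurable (K s)"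
  "(\<lambda>w. snd (snd w)) \<in> borel_measurable (K s)"
  using measurable_compose[OF measurable_fst half_line_borel]
    measurable_compose[OF measurable_compose[OF measurable_snd measurable_snd] N_borel] by auto

lemma HP_ident: "(\<lambda>w. w) \<in> half_line s \<Otimes>\<^sub>M P \<rightarrow>\<^sub>M K s"
proof -
  have "(\<lambda>w. (fst w, snd w)) \<in> half_line s \<Otimes>\<^sub>M P \<rightarrow>\<^sub>M K s"
    by (intro measurable_Pair measurable_fst measurable_compose[OF measurable_snd P_ident])
  then show ?thesis by simp
qed

lemma clear_paths_measurable:
  "(\<lambda>w. indicator (clear_paths \<Omega>) (fst w - s, fst (snd w), snd (snd w))) \<in> borel_measurable (K s)"
  "(\<lambda>w. indicator (clear_paths \<Omega>) (fst w - s, fst (snd w) + (fst w - s) *\<^sub>R snd (snd w), snd (snd w)))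
     \<in> borel_measurable (K s)"
proof -
  note [measurable] = K_coords
  have [measurable]: "clear_paths \<Omega> \<in> sets borel"
    using open_clear_paths[OF open_domain] by auto
  have *: "(\<lambda>w. (fst w - s, fst (snd w), snd (snd w))) \<in> borel_measurable (K s)"
    "(\<lambda>w. (fst w - s, fst (snd w) + (fst w - s) *\<^sub>R snd (snd w), snd (snd w))) \<in> borel_measurable (K s)"
    by (intro borel_measurable_Pair; measurable)+
  show "(\<lambda>w. indicator (clear_paths \<Omega>) (fst w - s, fst (snd w), snd (snd w))) \<in> borel_measurable (K s)"
    by (rule measurable_compose[OF *(1)]) simp
  show "(\<lambda>w. indicator (clear_paths \<Omega>) (fst w - s, fst (snd w) + (fst w - s) *\<^sub>R snd (snd w), snd (snd w)))
     \<in> borel_measurable (K s)"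
    by (rule measurable_compose[OF *(2)]) simp
qed

lemma U_op_measurable:
  assumes "0 \<le> s" and f: "f \<in> borel_measurable P"
  shows "(\<lambda>(t, z). U_op \<Omega> \<Sigma> t s f z) \<in> borel_measurable (half_line s \<Otimes>\<^sub>M P)"
proof -
  note [measurable] = K_coords
  have "(\<lambda>w. fst (snd w) - (fst w - s) *\<^sub>R snd (snd w)) \<in> borel_measurable (K s)" by measurable
  then have "(\<lambda>w. (fst (snd w) - (fst w - s) *\<^sub>R snd (snd w), snd (snd w))) \<in> K s \<rightarrow>\<^sub>M lborel \<Otimes>\<^sub>M N"
    by (intro measurable_Pair measurable_compose[OF measurable_snd measurable_snd]) simp
  from measurable_compose[OF this zero_ext_measurable[OF f]]
  have 1: "(\<lambda>w. zero_ext f (fst (snd w) - (fst w - s) *\<^sub>R snd (snd w), snd (snd w))) \<in> borel_measurable (K s)" .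
  have "(\<lambda>w. (fst w, snd (snd w))) \<in> K s \<rightarrow>\<^sub>M half_line s \<Otimes>\<^sub>M N" by measurable
  from measurable_compose[OF this attenuation_measurable[OF assms(1)]]
  have 2: "(\<lambda>w. attenuation s (fst w) (snd (snd w))) \<in> borel_measurable (K s)" by simp
  have "(\<lambda>w. attenuation s (fst w) (snd (snd w)) *
      indicator (clear_paths \<Omega>) (fst w - s, fst (snd w), snd (snd w)) *
      zero_ext f (fst (snd w) - (fst w - s) *\<^sub>R snd (snd w), snd (snd w))) \<in> borel_measurable (K s)"
    by (intro borel_measurable_times 1 2 clear_paths_measurable)
  from measurable_compose[OF HP_ident this] show ?thesis
    by (rule measurable_cong[THEN iffD1, rotated])
      (auto simp: space_pair_measure space_P U_op_eq)
qed

lemma U_op_measurable_at: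
  assumes "0 \<le> s" "s \<le> t" "f \<in> borel_measurable P"
  shows "U_op \<Omega> \<Sigma> t s f \<in> borel_measurable P"
  using measurable_Pair2[OF U_op_measurable[OF assms(1,3)], of t] assms(2) by simp

section \<open>Mass balance\<close>

lemma clear_paths_start: "(h, x, v) \<in> clear_paths \<Omega> \<Longrightarrow> x \<in> \<Omega>"
  unfolding clear_paths_def by (auto dest: bspec[of _ _ 0])

lemma K_section: "s \<le> t \<Longrightarrow> g \<in> borel_measurable (K s) \<Longrightarrow> (\<lambda>z. g (t, z)) \<in> borel_measurable (lborel \<Otimes>\<^sub>M N)"
  by (rule measurable_Pair2) auto

lemma attenuation_K: "0 \<le> s \<Longrightarrow> (\<lambda>w. attenuation s (fst w) (snd (snd w))) \<in> borel_measurable (K s)"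
  using measurable_compose[OF _ attenuation_measurable, of "\<lambda>w. (fst w, snd (snd w))" "K s" s] by simp

lemma \<Sigma>_K:
  assumes "0 \<le> s" shows "(\<lambda>w. \<Sigma> (fst w) (snd (snd w))) \<in> borel_measurable (K s)"
proof -
  have "(\<lambda>w. (fst w, snd (snd w))) \<in> K s \<rightarrow>\<^sub>M half_line 0 \<Otimes>\<^sub>M N"
    by (intro measurable_Pair measurable_compose[OF measurable_fst half_line_id_measurable[OF assms]]
        measurable_compose[OF measurable_snd measurable_snd])
  from measurable_compose[OF this \<Sigma>_measurable] show ?thesis by simp
qed

lemma nn_integral_P:
  assumes "g \<in> borel_measurable P"
  shows "(\<integral>\<^sup>+z. g z \<partial>P) = (\<integral>\<^sup>+v. \<integral>\<^sup>+x. g (x, v) * indicator \<Omega> x \<partial>lborel \<partial>N)"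
proof -
  have "(\<integral>\<^sup>+z. g z \<partial>P) = (\<integral>\<^sup>+v. \<integral>\<^sup>+x. g (x, v) \<partial>L \<partial>N)"
    using LN.nn_integral_snd[of g] assms unfolding P_eq by simp
  also have "\<dots> = (\<integral>\<^sup>+v. \<integral>\<^sup>+x. g (x, v) * indicator \<Omega> x \<partial>lborel \<partial>N)"
    using open_domain by (subst nn_integral_restrict_space) auto
  finally show ?thesis .
qed

lemma nn_integral_zero_ext:
  assumes f: "f \<in> borel_measurable P"
  shows "(\<integral>\<^sup>+z. ennreal \<bar>zero_ext f z\<bar> \<partial>(lborel \<Otimes>\<^sub>M N)) = (\<integral>\<^sup>+z. ennreal \<bar>f z\<bar> \<partial>P)"
proof -
  note [measurable] = zero_ext_measurable[OF f] f
  have "(\<integral>\<^sup>+z. ennreal \<bar>zero_ext f z\<bar> \<partial>(lborel \<Otimes>\<^sub>M N))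
    = (\<integral>\<^sup>+v. \<integral>\<^sup>+x. ennreal \<bar>zero_ext f (x, v)\<bar> \<partial>lborel \<partial>N)"
    by (rule RN.nn_integral_snd[symmetric]) measurable
  also have "\<dots> = (\<integral>\<^sup>+v. \<integral>\<^sup>+x. ennreal \<bar>f (x, v)\<bar> * indicator \<Omega> x \<partial>lborel \<partial>N)"
    by (intro nn_integral_cong) (auto simp: zero_ext_def indicator_def)
  also have "\<dots> = (\<integral>\<^sup>+z. ennreal \<bar>f z\<bar> \<partial>P)"
    by (rule nn_integral_P[symmetric]) measurable
  finally show ?thesis .
qed

text \<open>
  Whether the trajectory that starts at \<open>y\<close> at time \<open>s\<close> is still in the domain at time \<open>t\<close>. In terms of
  \<open>clear_paths\<close> this is the backward segment from the end point \<open>y + (t - s) v\<close>.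
\<close>

abbreviation "alive s t y v \<equiv> indicator (clear_paths \<Omega>) (t - s, y + (t - s) *\<^sub>R v, v)"

text \<open>
  The change of variables from the current position \<open>x\<close> to the starting position \<open>y = x - (t - s) v\<close>. The weight
  depends on the velocity alone and is unaffected; it is \<open>1\<close> for the norm of \<open>U(t, s) f\<close> and \<open>\<Sigma>(t, v)\<close> for
  that of \<open>\<Sigma>(t) U(t, s) f\<close>.
\<close>

lemma nn_integral_U_op:
  assumes "0 \<le> s" "s \<le> t" and f: "f \<in> borel_measurable P" and w: "w \<in> borel_measurable N"
  shows "(\<integral>\<^sup>+z. w (snd z) * ennreal \<bar>U_op \<Omega> \<Sigma> t s f z\<bar> \<partial>P) =
    (\<integral>\<^sup>+z. w (snd z) * ennreal (attenuation s t (snd z)) * ennreal \<bar>zero_ext f z\<bar> *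
      alive s t (fst z) (snd z) \<partial>(lborel \<Otimes>\<^sub>M N))"
proof -
  note [measurable] = zero_ext_measurable[OF f] U_op_measurable_at[OF assms(1-3)] w
  have "snd \<in> P \<rightarrow>\<^sub>M N" unfolding P_eq by simp
  from measurable_compose[OF this w] have [measurable]: "(\<lambda>z. w (snd z)) \<in> borel_measurable P" .
  have [measurable]: "(\<lambda>z. attenuation s t (snd z)) \<in> borel_measurable (lborel \<Otimes>\<^sub>M N)"
    using K_section[OF assms(2) attenuation_K[OF assms(1)]] by simp
  have [measurable]: "(\<lambda>z. alive s t (fst z) (snd z) :: ennreal) \<in> borel_measurable (lborel \<Otimes>\<^sub>M N)"
    using K_section[OF assms(2) clear_paths_measurable(2)] by simp
  have "(\<integral>\<^sup>+z. w (snd z) * ennreal \<bar>U_op \<Omega> \<Sigma> t s f z\<bar> \<partial>P) =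
    (\<integral>\<^sup>+v. \<integral>\<^sup>+x. w v * ennreal \<bar>U_op \<Omega> \<Sigma> t s f (x, v)\<bar> * indicator \<Omega> x \<partial>lborel \<partial>N)"
    by (subst nn_integral_P) auto
  also have "\<dots> = (\<integral>\<^sup>+v. \<integral>\<^sup>+y. w v * ennreal (attenuation s t v) * ennreal \<bar>zero_ext f (y, v)\<bar> *
      alive s t y v \<partial>lborel \<partial>N)"
  proof (rule nn_integral_cong)
    fix v assume v: "v \<in> space N"
    define h where "h = t - s"
    define g where "g x = w v * ennreal (attenuation s t v) * ennreal \<bar>zero_ext f (x - h *\<^sub>R v, v)\<bar> *
      indicator (clear_paths \<Omega>) (h, x, v)" for x
    have [measurable]: "(\<lambda>x. zero_ext f (x, v)) \<in> borel_measurable borel"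
      using measurable_Pair1[OF zero_ext_measurable[OF f] v] by simp
    have "(\<lambda>x. indicator (clear_paths \<Omega>) (h, x, v) :: ennreal) \<in> borel_measurable borel"
    proof -
      have [measurable]: "clear_paths \<Omega> \<in> sets borel"
        using open_clear_paths[OF open_domain] by auto
      have "(\<lambda>x :: 'a. (h, x, v)) \<in> borel_measurable borel"
        by (intro borel_measurable_Pair) auto
      from measurable_compose[OF this, of "indicator (clear_paths \<Omega>)"] show ?thesis by simp
    qed
    then have [measurable]: "g \<in> borel_measurable borel" unfolding g_def by measurable
    have "w v * ennreal \<bar>U_op \<Omega> \<Sigma> t s f (x, v)\<bar> * indicator \<Omega> x = g x" for x
    proof (cases "x \<in> \<Omega>")
      case True
      then show ?thesis using assms(2) unfolding g_def
        by (auto simp: U_op_eq h_def abs_mult ennreal_mult attenuation_def indicator_def mult.assoc)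
    next
      case False
      then show ?thesis using clear_paths_start by (auto simp: g_def indicator_def)
    qed
    then have "(\<integral>\<^sup>+x. w v * ennreal \<bar>U_op \<Omega> \<Sigma> t s f (x, v)\<bar> * indicator \<Omega> x \<partial>lborel) = (\<integral>\<^sup>+x. g x \<partial>lborel)"
      by simp
    also have "\<dots> = (\<integral>\<^sup>+y. g (h *\<^sub>R v + y) \<partial>lborel)"
      by (rule nn_integral_lborel_translate) measurable
    finally show "(\<integral>\<^sup>+x. w v * ennreal \<bar>U_op \<Omega> \<Sigma> t s f (x, v)\<bar> * indicator \<Omega> x \<partial>lborel) =
      (\<integral>\<^sup>+y. w v * ennreal (attenuation s t v) * ennreal \<bar>zero_ext f (y, v)\<bar> * alive s t y v \<partial>lborel)"
      by (simp add: g_def h_def add.commute)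
  qed
  also have "\<dots> = (\<integral>\<^sup>+z. w (snd z) * ennreal (attenuation s t (snd z)) * ennreal \<bar>zero_ext f z\<bar> *
      alive s t (fst z) (snd z) \<partial>(lborel \<Otimes>\<^sub>M N))"
    by (subst RN.nn_integral_snd[symmetric]) auto
  finally show ?thesis .
qed

text \<open>
  The mass balance of a single trajectory with the boundary ignored: the integral is the fraction of the
  initial mass removed by \<open>\<Sigma>\<close> up to time \<open>r\<close>, and \<open>attenuation s r v\<close> is the fraction that is left.
\<close>

lemma removal_plus_remaining_le:
  assumes "0 \<le> s" "s \<le> r" and v: "v \<in> measure_support \<mu>"
    and int: "\<forall>T\<ge>0. set_integrable lborel {0..T} (\<lambda>t. \<Sigma> t v)"
  shows "(\<integral>\<^sup>+t. indicator {..r} t * ennreal (\<Sigma> t v) * ennreal (attenuation s t v) \<partial>half_line s)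
    + ennreal (attenuation s r v) \<le> 1"
proof -
  have nonneg: "0 \<le> \<Sigma> t v" if "t \<in> {s..r}" for t using \<Sigma>_nonneg[of t v] v that assms(1) by auto
  have "set_integrable lborel {0..r} (\<lambda>t. \<Sigma> t v)"
    using int assms(1,2) by simp
  then have "set_integrable lborel {s..r} (\<lambda>t. \<Sigma> t v)"
    by (rule set_integrable_subset) (use assms(1) in auto)
  note nn_damped_integral_le[of s r "\<lambda>t. \<Sigma> t v", OF assms(2) this nonneg]
  then have "(\<integral>\<^sup>+t. indicator {s..r} t * ennreal (\<Sigma> t v * attenuation s t v) \<partial>lborel)
    + ennreal (attenuation s r v) \<le> 1"
    unfolding attenuation_def .
  moreover have "(\<integral>\<^sup>+t. indicator {..r} t * ennreal (\<Sigma> t v) * ennreal (attenuation s t v) \<partial>half_line s)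
    = (\<integral>\<^sup>+t. indicator {s..r} t * ennreal (\<Sigma> t v * attenuation s t v) \<partial>lborel)"
    unfolding nn_integral_half_line using nonneg
    by (intro nn_integral_cong) (auto simp: indicator_def ennreal_mult attenuation_def)
  ultimately show ?thesis by simp
qed

text \<open>
  In the coordinates of \<open>nn_integral_U_op\<close> the mass at \<open>(y, v)\<close> is a factor that does not depend on time. Tonelli's
  theorem therefore moves the time integral inside, where \<open>removal_plus_remaining_le\<close> bounds it. Bounding the
  indicator of the surviving trajectories by \<open>1\<close> in both terms discards exactly the boundary losses.
\<close>

lemma energy_estimate:
  assumes s: "0 \<le> s" "s \<le> r" and f: "f \<in> borel_measurable P"
  shows "(\<integral>\<^sup>+t. indicator {..r} t * (\<integral>\<^sup>+z. ennreal (\<Sigma> t (snd z)) * ennreal \<bar>U_op \<Omega> \<Sigma> t s f z\<bar> \<partial>P) \<partial>half_line s)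
    + (\<integral>\<^sup>+z. ennreal \<bar>U_op \<Omega> \<Sigma> r s f z\<bar> \<partial>P) \<le> (\<integral>\<^sup>+z. ennreal \<bar>f z\<bar> \<partial>P)"
proof -
  let ?Q = "lborel \<Otimes>\<^sub>M N"
  interpret Q: sigma_finite_measure ?Q
    by (rule sigma_finite_pair_measure) unfold_locales
  interpret HQ: pair_sigma_finite "half_line s" ?Q ..
  note [measurable] = zero_ext_measurable[OF f] \<Sigma>_K[OF s(1)] attenuation_K[OF s(1)]
    clear_paths_measurable(2) K_coords(1)
  have [measurable]: "(\<lambda>w. zero_ext f (snd w)) \<in> borel_measurable (K s)"
    by (rule measurable_compose[OF measurable_snd zero_ext_measurable[OF f]])
  define \<phi> where "\<phi> t z = indicator {..r} t * ennreal (\<Sigma> t (snd z)) * ennreal (attenuation s t (snd z)) *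
      ennreal \<bar>zero_ext f z\<bar> * alive s t (fst z) (snd z)" for t z
  define \<psi> where "\<psi> z = ennreal (attenuation s r (snd z)) * ennreal \<bar>zero_ext f z\<bar> *
      alive s r (fst z) (snd z)" for z
  have "(\<lambda>w. indicator {..r} (fst w) :: ennreal) \<in> borel_measurable (K s)"
    by (rule measurable_compose[OF K_coords(1)]) simp
  then have \<phi>[measurable]: "(\<lambda>w. \<phi> (fst w) (snd w)) \<in> borel_measurable (K s)"
    unfolding \<phi>_def by (intro borel_measurable_times_ennreal; measurable)
  have \<psi>[measurable]: "\<psi> \<in> borel_measurable ?Q"
  proof -
    have "(\<lambda>w. ennreal (attenuation s (fst w) (snd (snd w))) * ennreal \<bar>zero_ext f (snd w)\<bar> *
        (alive s (fst w) (fst (snd w)) (snd (snd w)) :: ennreal)) \<in> borel_measurable (K s)"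
      by (intro borel_measurable_times_ennreal; measurable)
    from K_section[OF s(2) this] show ?thesis unfolding \<psi>_def by simp
  qed
  have "(\<integral>\<^sup>+t. indicator {..r} t * (\<integral>\<^sup>+z. ennreal (\<Sigma> t (snd z)) * ennreal \<bar>U_op \<Omega> \<Sigma> t s f z\<bar> \<partial>P) \<partial>half_line s)
    = (\<integral>\<^sup>+t. \<integral>\<^sup>+z. \<phi> t z \<partial>?Q \<partial>half_line s)"
  proof (rule nn_integral_cong)
    fix t assume "t \<in> space (half_line s)"
    then have t: "s \<le> t" by simp
    have w: "(\<lambda>v. ennreal (\<Sigma> t v)) \<in> borel_measurable N"
      using measurable_Pair2[OF \<Sigma>_measurable, of t] t s by simp
    have X: "(\<lambda>z. ennreal (\<Sigma> t (snd z)) * ennreal (attenuation s t (snd z)) * ennreal \<bar>zero_ext f z\<bar> *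
      alive s t (fst z) (snd z)) \<in> borel_measurable ?Q"
    proof -
      have "(\<lambda>w. ennreal (\<Sigma> (fst w) (snd (snd w))) * ennreal (attenuation s (fst w) (snd (snd w))) * ennreal \<bar>zero_ext f (snd w)\<bar> *
        (alive s (fst w) (fst (snd w)) (snd (snd w)) :: ennreal)) \<in> borel_measurable (K s)"
        by (intro borel_measurable_times_ennreal; measurable)
      from K_section[OF t this] show ?thesis by simp
    qed
    show "indicator {..r} t * (\<integral>\<^sup>+z. ennreal (\<Sigma> t (snd z)) * ennreal \<bar>U_op \<Omega> \<Sigma> t s f z\<bar> \<partial>P) = (\<integral>\<^sup>+z. \<phi> t z \<partial>?Q)"
      unfolding nn_integral_U_op[OF s(1) t f w] \<phi>_def
      by (subst nn_integral_cmult[OF X, symmetric]) (simp only: mult.assoc)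
  qed
  also have "\<dots> = (\<integral>\<^sup>+z. \<integral>\<^sup>+t. \<phi> t z \<partial>half_line s \<partial>?Q)"
    using HQ.Fubini'[of \<phi>] \<phi> by (simp add: case_prod_beta')
  finally have 1: "(\<integral>\<^sup>+t. indicator {..r} t * (\<integral>\<^sup>+z. ennreal (\<Sigma> t (snd z)) * ennreal \<bar>U_op \<Omega> \<Sigma> t s f z\<bar> \<partial>P) \<partial>half_line s)
    = (\<integral>\<^sup>+z. \<integral>\<^sup>+t. \<phi> t z \<partial>half_line s \<partial>?Q)" .
  have 2: "(\<integral>\<^sup>+z. ennreal \<bar>U_op \<Omega> \<Sigma> r s f z\<bar> \<partial>P) = (\<integral>\<^sup>+z. \<psi> z \<partial>?Q)"
    using nn_integral_U_op[OF s f, of "\<lambda>_. 1"] by (simp add: \<psi>_def)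
  have inner[measurable]: "(\<lambda>z. \<integral>\<^sup>+t. \<phi> t z \<partial>half_line s) \<in> borel_measurable ?Q"
  proof -
    have "(\<lambda>w. \<phi> (snd w) (fst w)) \<in> borel_measurable (?Q \<Otimes>\<^sub>M half_line s)"
      using measurable_compose[OF measurable_pair_swap' \<phi>] by (simp add: case_prod_beta')
    then show ?thesis by (intro half_line.borel_measurable_nn_integral) (simp add: case_prod_beta')
  qed
  have "(\<integral>\<^sup>+z. \<integral>\<^sup>+t. \<phi> t z \<partial>half_line s \<partial>?Q) + (\<integral>\<^sup>+z. \<psi> z \<partial>?Q)
    = (\<integral>\<^sup>+z. (\<integral>\<^sup>+t. \<phi> t z \<partial>half_line s) + \<psi> z \<partial>?Q)"
    by (rule nn_integral_add[symmetric]) measurable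
  also have "\<dots> = (\<integral>\<^sup>+v. \<integral>\<^sup>+y. (\<integral>\<^sup>+t. \<phi> t (y, v) \<partial>half_line s) + \<psi> (y, v) \<partial>lborel \<partial>N)"
    by (rule RN.nn_integral_snd[symmetric]) measurable
  also have "\<dots> \<le> (\<integral>\<^sup>+v. \<integral>\<^sup>+y. ennreal \<bar>zero_ext f (y, v)\<bar> \<partial>lborel \<partial>N)"
  proof (rule nn_integral_mono_AE)
    show "AE v in N. (\<integral>\<^sup>+y. (\<integral>\<^sup>+t. \<phi> t (y, v) \<partial>half_line s) + \<psi> (y, v) \<partial>lborel)
      \<le> (\<integral>\<^sup>+y. ennreal \<bar>zero_ext f (y, v)\<bar> \<partial>lborel)"
      using \<Sigma>_integrable AE_space
    proof eventually_elim
      case (elim v)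
      then have v: "v \<in> space N" by simp
      show ?case
      proof (rule nn_integral_mono)
        fix y
        let ?F = "ennreal \<bar>zero_ext f (y, v)\<bar>"
        let ?d = "\<lambda>t. indicator {..r} t * ennreal (\<Sigma> t v) * ennreal (attenuation s t v)"
        have [measurable]: "?d \<in> borel_measurable (half_line s)"
        proof -
          have "(\<lambda>w. indicator {..r} (fst w) * ennreal (\<Sigma> (fst w) (snd (snd w))) *
              ennreal (attenuation s (fst w) (snd (snd w)))) \<in> borel_measurable (K s)"
            using \<open>(\<lambda>w. indicator {..r} (fst w)) \<in> borel_measurable (K s)\<close>
            by (intro borel_measurable_times_ennreal; measurable)
          from measurable_Pair1[OF this, of "(y, v)"] v show ?thesis by (simp add: space_pair_measure)
        qed
        have "(\<integral>\<^sup>+t. \<phi> t (y, v) \<partial>half_line s) + \<psi> (y, v)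
          \<le> (\<integral>\<^sup>+t. ?F * ?d t \<partial>half_line s) + ?F * ennreal (attenuation s r v)"
          unfolding \<phi>_def \<psi>_def
          by (intro add_mono nn_integral_mono) (auto simp: indicator_def mult_ac)
        also have "\<dots> = ?F * ((\<integral>\<^sup>+t. ?d t \<partial>half_line s) + ennreal (attenuation s r v))"
          by (subst nn_integral_cmult) (auto simp: distrib_left)
        also have "\<dots> \<le> ?F * 1"
          using removal_plus_remaining_le[OF s] elim by (intro mult_left_mono) auto
        finally show "(\<integral>\<^sup>+t. \<phi> t (y, v) \<partial>half_line s) + \<psi> (y, v) \<le> ?F" by simp
      qed
    qed
  qed
  also have "\<dots> = (\<integral>\<^sup>+z. ennreal \<bar>zero_ext f z\<bar> \<partial>?Q)"
    by (rule RN.nn_integral_snd) measurable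
  also have "\<dots> = (\<integral>\<^sup>+z. ennreal \<bar>f z\<bar> \<partial>P)" by (rule nn_integral_zero_ext[OF f])
  finally show ?thesis unfolding 1 2 .
qed

section \<open>Collisions\<close>

lemma P_coords: "fst \<in> P \<rightarrow>\<^sub>M L" "snd \<in> P \<rightarrow>\<^sub>M N"
  unfolding P_eq by auto

lemma Pair_P: "f \<in> M \<rightarrow>\<^sub>M L \<Longrightarrow> g \<in> M \<rightarrow>\<^sub>M N \<Longrightarrow> (\<lambda>w. (f w, g w)) \<in> M \<rightarrow>\<^sub>M P"
  unfolding P_eq by (rule measurable_Pair)

lemma b_compose:
  assumes "t \<in> M \<rightarrow>\<^sub>M half_line 0" "v \<in> M \<rightarrow>\<^sub>M N" "v' \<in> M \<rightarrow>\<^sub>M N"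
  shows "(\<lambda>w. b (t w) (v w) (v' w)) \<in> borel_measurable M"
proof -
  have "(\<lambda>w. (t w, v w, v' w)) \<in> M \<rightarrow>\<^sub>M half_line 0 \<Otimes>\<^sub>M N \<Otimes>\<^sub>M N"
    by (intro measurable_Pair assms)
  from measurable_compose[OF this b_measurable] show ?thesis by simp
qed

lemma coll_freq_measurable:
  assumes "0 \<le> t"
  shows "coll_freq \<mu> b t \<in> borel_measurable N"
proof -
  have [measurable]: "(\<lambda>w. b t (snd w) (fst w)) \<in> borel_measurable (N \<Otimes>\<^sub>M N)"
    using assms by (intro b_compose) auto
  show ?thesis unfolding coll_freq_def[abs_def] by measurable
qed

text \<open>
  Integrating the outgoing velocity \<open>v\<close> first turns the kernel \<open>b(t, v, v')\<close> into the collision frequency at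
  the incoming velocity \<open>v'\<close>.
\<close>

lemma nn_integral_B_op_le:
  assumes t: "0 \<le> t" and \<phi>: "\<phi> \<in> borel_measurable P"
  shows "(\<integral>\<^sup>+z. ennreal \<bar>B_op \<mu> b t \<phi> z\<bar> \<partial>P) \<le> (\<integral>\<^sup>+z. coll_freq \<mu> b t (snd z) * ennreal \<bar>\<phi> z\<bar> \<partial>P)"
proof -
  have [measurable]: "(\<lambda>w. b t (snd (fst w)) (snd w)) \<in> borel_measurable ((L \<Otimes>\<^sub>M N) \<Otimes>\<^sub>M N)"
    using t by (intro b_compose measurable_compose[OF measurable_fst measurable_snd] measurable_snd) auto
  have [measurable]: "(\<lambda>w. \<phi> (fst (fst w), snd w)) \<in> borel_measurable ((L \<Otimes>\<^sub>M N) \<Otimes>\<^sub>M N)"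
    by (intro measurable_compose[OF _ \<phi>] Pair_P measurable_compose[OF measurable_fst measurable_fst] measurable_snd)
  note [measurable] = coll_freq_measurable[OF t] \<phi>[unfolded P_eq]
  let ?I = "\<lambda>x v v'. ennreal \<bar>b t v v' * \<phi> (x, v')\<bar>"
  have "(\<integral>\<^sup>+z. ennreal \<bar>B_op \<mu> b t \<phi> z\<bar> \<partial>P) \<le> (\<integral>\<^sup>+z. \<integral>\<^sup>+v'. ?I (fst z) (snd z) v' \<partial>N \<partial>P)"
    by (intro nn_integral_mono) (auto simp: B_op_def case_prod_beta' intro: ennreal_abs_integral_le)
  also have "\<dots> = (\<integral>\<^sup>+x. \<integral>\<^sup>+v. \<integral>\<^sup>+v'. ?I x v v' \<partial>N \<partial>N \<partial>L)"
    unfolding P_eq by (subst N.nn_integral_fst[symmetric]) auto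
  also have "\<dots> = (\<integral>\<^sup>+x. \<integral>\<^sup>+v'. coll_freq \<mu> b t v' * ennreal \<bar>\<phi> (x, v')\<bar> \<partial>N \<partial>L)"
  proof (rule nn_integral_cong)
    fix x assume x: "x \<in> space L"
    interpret NN: pair_sigma_finite N N ..
    have [measurable]: "(\<lambda>(v, v'). b t v v') \<in> borel_measurable (N \<Otimes>\<^sub>M N)"
      unfolding case_prod_beta' using t by (intro b_compose) auto
    have [measurable]: "(\<lambda>v. \<phi> (x, v)) \<in> borel_measurable N"
      using measurable_Pair2[OF \<phi>[unfolded P_eq] x] .
    have "(\<integral>\<^sup>+v. \<integral>\<^sup>+v'. ?I x v v' \<partial>N \<partial>N) = (\<integral>\<^sup>+v'. \<integral>\<^sup>+v. ?I x v v' \<partial>N \<partial>N)"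
      by (rule NN.Fubini'[symmetric]) measurable
    also have "\<dots> = (\<integral>\<^sup>+v'. coll_freq \<mu> b t v' * ennreal \<bar>\<phi> (x, v')\<bar> \<partial>N)"
    proof (rule nn_integral_cong)
      fix v' assume v': "v' \<in> space N"
      have [measurable]: "(\<lambda>v. b t v v') \<in> borel_measurable N"
        using t v' by (intro b_compose) auto
      have "(\<integral>\<^sup>+v. ?I x v v' \<partial>N) = (\<integral>\<^sup>+v. ennreal (b t v v') * ennreal \<bar>\<phi> (x, v')\<bar> \<partial>N)"
        using b_nonneg[OF t] v' by (intro nn_integral_cong) (auto simp: abs_mult ennreal_mult)
      also have "\<dots> = coll_freq \<mu> b t v' * ennreal \<bar>\<phi> (x, v')\<bar>"
        unfolding coll_freq_def by (rule nn_integral_multc) measurable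
      finally show "(\<integral>\<^sup>+v. ?I x v v' \<partial>N) = coll_freq \<mu> b t v' * ennreal \<bar>\<phi> (x, v')\<bar>" .
    qed
    finally show "(\<integral>\<^sup>+v. \<integral>\<^sup>+v'. ?I x v v' \<partial>N \<partial>N) = (\<integral>\<^sup>+v'. coll_freq \<mu> b t v' * ennreal \<bar>\<phi> (x, v')\<bar> \<partial>N)" .
  qed
  also have "\<dots> = (\<integral>\<^sup>+z. coll_freq \<mu> b t (snd z) * ennreal \<bar>\<phi> z\<bar> \<partial>P)"
    unfolding P_eq by (subst N.nn_integral_fst[symmetric]) auto
  finally show ?thesis .
qed

lemma nn_integral_coll_freq_le:
  assumes t: "0 \<le> t" and \<phi>: "\<phi> \<in> borel_measurable P"
    and le: "AE v in N. coll_freq \<mu> b t v \<le> ennreal (\<Sigma> t v)"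
  shows "(\<integral>\<^sup>+z. coll_freq \<mu> b t (snd z) * ennreal \<bar>\<phi> z\<bar> \<partial>P)
    \<le> (\<integral>\<^sup>+z. ennreal (\<Sigma> t (snd z)) * ennreal \<bar>\<phi> z\<bar> \<partial>P)"
proof -
  have [measurable]: "\<Sigma> t \<in> borel_measurable N"
    using measurable_Pair2[OF \<Sigma>_measurable, of t] t by simp
  note [measurable] = coll_freq_measurable[OF t] \<phi>[unfolded P_eq]
  have "(\<integral>\<^sup>+x. \<integral>\<^sup>+v. coll_freq \<mu> b t v * ennreal \<bar>\<phi> (x, v)\<bar> \<partial>N \<partial>L)
    \<le> (\<integral>\<^sup>+x. \<integral>\<^sup>+v. ennreal (\<Sigma> t v) * ennreal \<bar>\<phi> (x, v)\<bar> \<partial>N \<partial>L)"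
    by (rule nn_integral_mono, rule nn_integral_mono_AE)
      (use le in \<open>auto elim!: eventually_mono intro!: mult_right_mono\<close>)
  then show ?thesis
    unfolding P_eq by (subst (1 2) N.nn_integral_fst[symmetric]) auto
qed

lemma AE_subcritical:
  assumes "0 \<le> s"
  shows "AE t in half_line s. AE v in N. coll_freq \<mu> b t v \<le> ennreal (\<Sigma> t v)"
proof -
  have "AE t in half_line 0. AE v in N. coll_freq \<mu> b t v \<le> ennreal (\<Sigma> t v)"
    using HN.AE_pair[OF subcritical] by (simp add: coll_freq_def)
  then show ?thesis unfolding AE_half_line by (rule eventually_mono) (use assms in auto)
qed

lemma Sigma_op_measurable:
  assumes "0 \<le> s" "f \<in> borel_measurable P"
  shows "(\<lambda>w. Sigma_op \<Sigma> (fst w) (U_op \<Omega> \<Sigma> (fst w) s f) (snd w)) \<in> borel_measurable (half_line s \<Otimes>\<^sub>M P)"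
proof -
  have [measurable]: "(\<lambda>w. U_op \<Omega> \<Sigma> (fst w) s f (snd w)) \<in> borel_measurable (half_line s \<Otimes>\<^sub>M P)"
    using U_op_measurable[OF assms] by (simp add: case_prod_beta')
  have [measurable]: "(\<lambda>w. \<Sigma> (fst w) (snd (snd w))) \<in> borel_measurable (half_line s \<Otimes>\<^sub>M P)"
    by (rule measurable_compose[OF HP_ident \<Sigma>_K[OF assms(1)]])
  show ?thesis unfolding Sigma_op_def by (simp add: case_prod_beta')
qed

lemma B_op_measurable:
  assumes "0 \<le> s" "f \<in> borel_measurable P"
  shows "(\<lambda>w. B_op \<mu> b (fst w) (U_op \<Omega> \<Sigma> (fst w) s f) (snd w)) \<in> borel_measurable (half_line s \<Otimes>\<^sub>M P)"
proof -
  let ?M = "(half_line s \<Otimes>\<^sub>M P) \<Otimes>\<^sub>M N"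
  have t: "(\<lambda>w. fst (fst w)) \<in> ?M \<rightarrow>\<^sub>M half_line s" by simp
  have x: "(\<lambda>w. fst (snd (fst w))) \<in> ?M \<rightarrow>\<^sub>M L" and v: "(\<lambda>w. snd (snd (fst w))) \<in> ?M \<rightarrow>\<^sub>M N"
    by (intro measurable_compose[OF _ P_coords(1)] measurable_compose[OF _ P_coords(2)]
        measurable_compose[OF measurable_fst measurable_snd])+
  have [measurable]: "(\<lambda>w. b (fst (fst w)) (snd (snd (fst w))) (snd w)) \<in> borel_measurable ?M"
    by (intro b_compose measurable_compose[OF t half_line_id_measurable[OF assms(1)]] v measurable_snd)
  have "(\<lambda>w. (fst (fst w), (fst (snd (fst w)), snd w))) \<in> ?M \<rightarrow>\<^sub>M half_line s \<Otimes>\<^sub>M P"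
    by (intro measurable_Pair t Pair_P x measurable_snd)
  from measurable_compose[OF this U_op_measurable[OF assms]]
  have [measurable]: "(\<lambda>w. U_op \<Omega> \<Sigma> (fst (fst w)) s f (fst (snd (fst w)), snd w)) \<in> borel_measurable ?M"
    by simp
  have "(\<lambda>w. \<integral>v'. b (fst w) (snd (snd w)) v' * U_op \<Omega> \<Sigma> (fst w) s f (fst (snd w), v') \<partial>N)
    \<in> borel_measurable (half_line s \<Otimes>\<^sub>M P)"
    by (intro N.borel_measurable_lebesgue_integral) (simp add: case_prod_beta')
  then show ?thesis unfolding B_op_def by (simp add: case_prod_beta')
qed

lemma abs_Sigma_op:
  "0 \<le> t \<Longrightarrow> z \<in> space P \<Longrightarrow> ennreal \<bar>Sigma_op \<Sigma> t \<phi> z\<bar> = ennreal (\<Sigma> t (snd z)) * ennreal \<bar>\<phi> z\<bar>"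
  using \<Sigma>_nonneg[of t "snd z"] by (auto simp: space_P Sigma_op_def abs_mult ennreal_mult)

lemma nn_integral_Sigma_op:
  "0 \<le> t \<Longrightarrow> (\<integral>\<^sup>+z. ennreal \<bar>Sigma_op \<Sigma> t \<phi> z\<bar> \<partial>P)
    = (\<integral>\<^sup>+z. ennreal (\<Sigma> t (snd z)) * ennreal \<bar>\<phi> z\<bar> \<partial>P)"
  by (intro nn_integral_cong abs_Sigma_op)

text \<open>
  The bound in \<open>energy_estimate\<close> does not depend on the final time, so integrability holds on the whole
  half-line and not only locally.
\<close>

lemma integrable_Sigma_op:
  assumes s: "0 \<le> s" and f: "integrable P f"
  shows "integrable (half_line s \<Otimes>\<^sub>M P) (\<lambda>w. Sigma_op \<Sigma> (fst w) (U_op \<Omega> \<Sigma> (fst w) s f) (snd w))"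
proof (rule integrableI_bounded)
  have fm: "f \<in> borel_measurable P" using f by auto
  note [measurable] = Sigma_op_measurable[OF s fm]
  show "(\<lambda>w. Sigma_op \<Sigma> (fst w) (U_op \<Omega> \<Sigma> (fst w) s f) (snd w)) \<in> borel_measurable (half_line s \<Otimes>\<^sub>M P)"
    by measurable
  let ?g = "\<lambda>t. \<integral>\<^sup>+z. ennreal \<bar>Sigma_op \<Sigma> t (U_op \<Omega> \<Sigma> t s f) z\<bar> \<partial>P"
  have "(\<integral>\<^sup>+w. ennreal (norm (Sigma_op \<Sigma> (fst w) (U_op \<Omega> \<Sigma> (fst w) s f) (snd w))) \<partial>(half_line s \<Otimes>\<^sub>M P))
    = (\<integral>\<^sup>+t. ?g t \<partial>half_line s)"
    by (subst P.nn_integral_fst[symmetric]) auto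
  also have "\<dots> \<le> (\<integral>\<^sup>+z. ennreal \<bar>f z\<bar> \<partial>P)"
  proof (rule nn_integral_half_line_le)
    show "?g \<in> borel_measurable (half_line s)"
      by (intro P.borel_measurable_nn_integral) (simp add: case_prod_beta')
    fix r assume r: "s \<le> r"
    have "(\<integral>\<^sup>+t. indicator {..r} t * ?g t \<partial>half_line s) = (\<integral>\<^sup>+t. indicator {..r} t *
        (\<integral>\<^sup>+z. ennreal (\<Sigma> t (snd z)) * ennreal \<bar>U_op \<Omega> \<Sigma> t s f z\<bar> \<partial>P) \<partial>half_line s)"
      using s by (intro nn_integral_cong) (simp add: nn_integral_Sigma_op)
    also have "\<dots> \<le> (\<integral>\<^sup>+z. ennreal \<bar>f z\<bar> \<partial>P)"
      using energy_estimate[OF s r fm] by (rule order_trans[rotated]) simp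
    finally show "(\<integral>\<^sup>+t. indicator {..r} t * ?g t \<partial>half_line s) \<le> (\<integral>\<^sup>+z. ennreal \<bar>f z\<bar> \<partial>P)" .
  qed
  also have "\<dots> < \<infinity>" using f by (simp add: integrable_iff_bounded)
  finally show "(\<integral>\<^sup>+w. ennreal (norm (Sigma_op \<Sigma> (fst w) (U_op \<Omega> \<Sigma> (fst w) s f) (snd w))) \<partial>(half_line s \<Otimes>\<^sub>M P)) < \<infinity>" .
qed

lemma AE_coll_freq_le_Sigma_op:
  assumes s: "0 \<le> s" and f: "f \<in> borel_measurable P"
  shows "AE t in half_line s.
    (\<integral>\<^sup>+z. coll_freq \<mu> b t (snd z) * ennreal \<bar>U_op \<Omega> \<Sigma> t s f z\<bar> \<partial>P)
      \<le> (\<integral>\<^sup>+z. ennreal \<bar>Sigma_op \<Sigma> t (U_op \<Omega> \<Sigma> t s f) z\<bar> \<partial>P)"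
  using AE_subcritical[OF s] AE_space
proof eventually_elim
  case (elim t)
  then have t: "0 \<le> t" "s \<le> t" using s by auto
  show ?case
    using nn_integral_coll_freq_le[OF t(1) U_op_measurable_at[OF s t(2) f] elim(1)]
    by (simp add: nn_integral_Sigma_op[OF t(1)])
qed

lemma AE_B_op_le_Sigma_op:
  assumes s: "0 \<le> s" and f: "f \<in> borel_measurable P"
  shows "AE t in half_line s.
    (\<integral>\<^sup>+z. ennreal \<bar>B_op \<mu> b t (U_op \<Omega> \<Sigma> t s f) z\<bar> \<partial>P)
      \<le> (\<integral>\<^sup>+z. ennreal \<bar>Sigma_op \<Sigma> t (U_op \<Omega> \<Sigma> t s f) z\<bar> \<partial>P)"
  using AE_coll_freq_le_Sigma_op[OF s f] AE_space
proof eventually_elim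
  case (elim t)
  then have t: "0 \<le> t" "s \<le> t" using s by auto
  show ?case
    using nn_integral_B_op_le[OF t(1) U_op_measurable_at[OF s t(2) f]] elim(1) by (rule order_trans)
qed

lemma integrable_B_op:
  assumes s: "0 \<le> s" and f: "integrable P f"
  shows "integrable (half_line s \<Otimes>\<^sub>M P) (\<lambda>w. B_op \<mu> b (fst w) (U_op \<Omega> \<Sigma> (fst w) s f) (snd w))"
proof (rule integrableI_bounded)
  have fm: "f \<in> borel_measurable P" using f by auto
  note [measurable] = B_op_measurable[OF s fm] Sigma_op_measurable[OF s fm]
  show "(\<lambda>w. B_op \<mu> b (fst w) (U_op \<Omega> \<Sigma> (fst w) s f) (snd w)) \<in> borel_measurable (half_line s \<Otimes>\<^sub>M P)"
    by measurable
  have "(\<integral>\<^sup>+w. ennreal (norm (B_op \<mu> b (fst w) (U_op \<Omega> \<Sigma> (fst w) s f) (snd w))) \<partial>(half_line s \<Otimes>\<^sub>M P))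
    = (\<integral>\<^sup>+t. \<integral>\<^sup>+z. ennreal \<bar>B_op \<mu> b t (U_op \<Omega> \<Sigma> t s f) z\<bar> \<partial>P \<partial>half_line s)"
    by (subst P.nn_integral_fst[symmetric]) auto
  also have "\<dots> \<le> (\<integral>\<^sup>+t. \<integral>\<^sup>+z. ennreal \<bar>Sigma_op \<Sigma> t (U_op \<Omega> \<Sigma> t s f) z\<bar> \<partial>P \<partial>half_line s)"
    by (rule nn_integral_mono_AE[OF AE_B_op_le_Sigma_op[OF s fm]])
  also have "\<dots> = (\<integral>\<^sup>+w. ennreal (norm (Sigma_op \<Sigma> (fst w) (U_op \<Omega> \<Sigma> (fst w) s f) (snd w))) \<partial>(half_line s \<Otimes>\<^sub>M P))"
    by (subst P.nn_integral_fst[symmetric]) auto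
  also have "\<dots> < \<infinity>" using integrable_Sigma_op[OF s f] by (simp add: integrable_iff_bounded)
  finally show "(\<integral>\<^sup>+w. ennreal (norm (B_op \<mu> b (fst w) (U_op \<Omega> \<Sigma> (fst w) s f) (snd w))) \<partial>(half_line s \<Otimes>\<^sub>M P)) < \<infinity>" .
qed

lemma integrable_U_op:
  assumes "0 \<le> s" "s \<le> t" and f: "integrable P f"
  shows "integrable P (U_op \<Omega> \<Sigma> t s f)"
proof (rule integrableI_bounded)
  have fm: "f \<in> borel_measurable P" using f by auto
  show "U_op \<Omega> \<Sigma> t s f \<in> borel_measurable P" by (rule U_op_measurable_at[OF assms(1,2) fm])
  have "(\<integral>\<^sup>+z. ennreal (norm (U_op \<Omega> \<Sigma> t s f z)) \<partial>P) \<le> (\<integral>\<^sup>+z. ennreal \<bar>f z\<bar> \<partial>P)"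
    using energy_estimate[OF assms(1,2) fm] by (rule order_trans[rotated]) simp
  also have "\<dots> < \<infinity>" using f by (simp add: integrable_iff_bounded)
  finally show "(\<integral>\<^sup>+z. ennreal (norm (U_op \<Omega> \<Sigma> t s f z)) \<partial>P) < \<infinity>" .
qed

lemma set_integrable_L1_norm:
  assumes G: "integrable (half_line s \<Otimes>\<^sub>M P) (\<lambda>w. G (fst w) (snd w))"
  shows "set_integrable lborel {s..r} (\<lambda>t. L1_norm P (G t))"
proof -
  have "integrable (half_line s) (\<lambda>t. L1_norm P (G t))"
    using HP.integrable_fst'[OF integrable_abs[OF G]] by (simp add: L1_norm_def)
  then have "set_integrable lborel {s..} (\<lambda>t. L1_norm P (G t))"
    unfolding half_line_def by (simp add: set_integrable_eq)
  then show ?thesis by (rule set_integrable_subset) auto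
qed

text \<open>
  The bridge between the norms as real numbers and the nonnegative integrals of the mass balance. They agree
  at almost every time, namely when the section is integrable; elsewhere the real integral is zero by
  convention.
\<close>

lemma ennreal_set_integral_L1_norm:
  assumes G: "integrable (half_line s \<Otimes>\<^sub>M P) (\<lambda>w. G (fst w) (snd w))"
  shows "ennreal (LBINT t:{s..r}. L1_norm P (G t))
    = (\<integral>\<^sup>+t. indicator {..r} t * (\<integral>\<^sup>+z. ennreal \<bar>G t z\<bar> \<partial>P) \<partial>half_line s)"
proof -
  have "ennreal (LBINT t:{s..r}. L1_norm P (G t)) = (\<integral>\<^sup>+t. ennreal (indicator {s..r} t *\<^sub>R L1_norm P (G t)) \<partial>lborel)"
    using set_integrable_L1_norm[OF G, of r] unfolding set_lebesgue_integral_def set_integrable_def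
    by (intro nn_integral_eq_integral[symmetric]) (auto simp: L1_norm_def)
  also have "\<dots> = (\<integral>\<^sup>+t. indicator {..r} t * ennreal (L1_norm P (G t)) \<partial>half_line s)"
    unfolding nn_integral_half_line by (intro nn_integral_cong) (auto simp: indicator_def)
  also have "\<dots> = (\<integral>\<^sup>+t. indicator {..r} t * (\<integral>\<^sup>+z. ennreal \<bar>G t z\<bar> \<partial>P) \<partial>half_line s)"
    using HP.AE_integrable_fst'[OF G]
    by (intro nn_integral_cong_AE) (auto elim!: eventually_mono simp: ennreal_L1_norm)
  finally show ?thesis .
qed

lemma set_integral_B_op_le:
  assumes s: "0 \<le> s" and f: "integrable P f"
  shows "(LBINT t:{s..r}. L1_norm P (B_op \<mu> b t (U_op \<Omega> \<Sigma> t s f)))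
    \<le> (LBINT t:{s..r}. L1_norm P (Sigma_op \<Sigma> t (U_op \<Omega> \<Sigma> t s f)))"
proof -
  have fm: "f \<in> borel_measurable P" using f by auto
  have "ennreal (LBINT t:{s..r}. L1_norm P (B_op \<mu> b t (U_op \<Omega> \<Sigma> t s f)))
    \<le> ennreal (LBINT t:{s..r}. L1_norm P (Sigma_op \<Sigma> t (U_op \<Omega> \<Sigma> t s f)))"
    unfolding ennreal_set_integral_L1_norm[OF integrable_B_op[OF s f]]
      ennreal_set_integral_L1_norm[OF integrable_Sigma_op[OF s f]]
    using AE_B_op_le_Sigma_op[OF s fm]
    by (intro nn_integral_mono_AE) (auto elim!: eventually_mono intro!: mult_left_mono)
  moreover have "0 \<le> (LBINT t:{s..r}. L1_norm P (Sigma_op \<Sigma> t (U_op \<Omega> \<Sigma> t s f)))"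
    unfolding set_lebesgue_integral_def L1_norm_def by (intro integral_nonneg_AE) auto
  ultimately show ?thesis by (simp add: ennreal_le_iff)
qed

lemma set_integral_Sigma_op_le:
  assumes s: "0 \<le> s" "s \<le> r" and f: "integrable P f"
  shows "(LBINT t:{s..r}. L1_norm P (Sigma_op \<Sigma> t (U_op \<Omega> \<Sigma> t s f)))
    \<le> L1_norm P f - L1_norm P (U_op \<Omega> \<Sigma> r s f)"
proof -
  have fm: "f \<in> borel_measurable P" using f by auto
  have nonneg: "0 \<le> L1_norm P g" for g by (simp add: L1_norm_def)
  have nonneg': "0 \<le> (LBINT t:{s..r}. L1_norm P (Sigma_op \<Sigma> t (U_op \<Omega> \<Sigma> t s f)))"
    unfolding set_lebesgue_integral_def L1_norm_def by (intro integral_nonneg_AE) auto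
  have "ennreal ((LBINT t:{s..r}. L1_norm P (Sigma_op \<Sigma> t (U_op \<Omega> \<Sigma> t s f))) + L1_norm P (U_op \<Omega> \<Sigma> r s f))
    = (\<integral>\<^sup>+t. indicator {..r} t * (\<integral>\<^sup>+z. ennreal (\<Sigma> t (snd z)) * ennreal \<bar>U_op \<Omega> \<Sigma> t s f z\<bar> \<partial>P) \<partial>half_line s)
      + (\<integral>\<^sup>+z. ennreal \<bar>U_op \<Omega> \<Sigma> r s f z\<bar> \<partial>P)"
    unfolding ennreal_plus[OF nonneg' nonneg] ennreal_set_integral_L1_norm[OF integrable_Sigma_op[OF s(1) f]]
      ennreal_L1_norm[OF integrable_U_op[OF s f]]
    using s(1) by (intro arg_cong2[where f = "(+)"] nn_integral_cong) (simp_all add: nn_integral_Sigma_op)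
  also have "\<dots> \<le> ennreal (L1_norm P f)"
    using energy_estimate[OF s fm] by (simp add: ennreal_L1_norm[OF f])
  finally show ?thesis using nonneg by (simp add: ennreal_le_iff)
qed

lemma AE_U_op_in_domains:
  assumes s: "0 \<le> s" and f: "integrable P f"
  shows "AE t in half_line s. U_op \<Omega> \<Sigma> t s f \<in> Sigma_dom \<Omega> \<mu> \<Sigma> t \<and> U_op \<Omega> \<Sigma> t s f \<in> B_dom \<Omega> \<mu> b t"
proof -
  have fm: "f \<in> borel_measurable P" using f by auto
  show ?thesis
    using HP.AE_integrable_fst'[OF integrable_Sigma_op[OF s f]] AE_coll_freq_le_Sigma_op[OF s fm] AE_space
  proof eventually_elim
    case (elim t)
    then have t: "s \<le> t" "0 \<le> t" using s by auto
    have fin: "(\<integral>\<^sup>+z. ennreal \<bar>Sigma_op \<Sigma> t (U_op \<Omega> \<Sigma> t s f) z\<bar> \<partial>P) < \<infinity>"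
      using elim(1) by (simp add: integrable_iff_bounded)
    have "(\<integral>\<^sup>+(x, v). ennreal (\<Sigma> t v * \<bar>U_op \<Omega> \<Sigma> t s f (x, v)\<bar>) \<partial>P)
      = (\<integral>\<^sup>+z. ennreal \<bar>Sigma_op \<Sigma> t (U_op \<Omega> \<Sigma> t s f) z\<bar> \<partial>P)"
      using \<Sigma>_nonneg[OF t(2)] by (intro nn_integral_cong) (auto simp: space_P Sigma_op_def abs_mult)
    moreover have "(\<integral>\<^sup>+(x, v). coll_freq \<mu> b t v * ennreal \<bar>U_op \<Omega> \<Sigma> t s f (x, v)\<bar> \<partial>P)
      \<le> (\<integral>\<^sup>+z. ennreal \<bar>Sigma_op \<Sigma> t (U_op \<Omega> \<Sigma> t s f) z\<bar> \<partial>P)"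
      using elim(2) by (simp add: case_prod_beta')
    ultimately show ?case
      using fin integrable_U_op[OF s t(1) f] by (auto simp: Sigma_dom_def B_dom_def L1_space_def)
  qed
qed

lemma B_op_strongly_measurable:
  assumes "0 \<le> s" "integrable P f"
  shows "L1_strongly_measurable (half_line s) P (\<lambda>t. B_op \<mu> b t (U_op \<Omega> \<Sigma> t s f))"
  using HP.integrable_imp_L1_strongly_measurable[OF integrable_B_op[OF assms]] by simp

end

theorem corollary5p12:
  fixes \<Omega> :: "'a::euclidean_space set"
    and \<mu> :: "'a measure"
    and \<Sigma> :: "real \<Rightarrow> 'a \<Rightarrow> real"
    and b :: "real \<Rightarrow> 'a \<Rightarrow> 'a \<Rightarrow> real"
  assumes "open \<Omega>"
    and "sets \<mu> = sets borel"
    and "sigma_finite_measure \<mu>"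
    and "(\<lambda>(t, v). \<Sigma> t v) \<in> borel_measurable (half_line 0 \<Otimes>\<^sub>M velocity_measure \<mu>)"
    and "\<And>t v. 0 \<le> t \<Longrightarrow> v \<in> measure_support \<mu> \<Longrightarrow> 0 \<le> \<Sigma> t v"
    and "AE v in velocity_measure \<mu>. \<forall>T\<ge>0. set_integrable lborel {0..T} (\<lambda>t. \<Sigma> t v)"
    and "(\<lambda>(t, v, v'). b t v v') \<in> borel_measurable
           (half_line 0 \<Otimes>\<^sub>M velocity_measure \<mu> \<Otimes>\<^sub>M velocity_measure \<mu>)"
    and "\<And>t v v'. 0 \<le> t \<Longrightarrow> v \<in> measure_support \<mu> \<Longrightarrow> v' \<in> measure_support \<mu>
           \<Longrightarrow> 0 \<le> b t v v'"
    and "AE (t, v') in half_line 0 \<Otimes>\<^sub>M velocity_measure \<mu>.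
           (\<integral>\<^sup>+v. ennreal (b t v v') \<partial>velocity_measure \<mu>) \<le> ennreal (\<Sigma> t v')"
  shows "\<forall>s\<ge>0. \<forall>f\<in>L1_cone (phase_measure \<Omega> \<mu>).
    (AE t in half_line s. U_op \<Omega> \<Sigma> t s f \<in> B_dom \<Omega> \<mu> b t) \<and>
    L1_strongly_measurable (half_line s) (phase_measure \<Omega> \<mu>)
      (\<lambda>t. B_op \<mu> b t (U_op \<Omega> \<Sigma> t s f)) \<and>
    (AE t in half_line s. U_op \<Omega> \<Sigma> t s f \<in> Sigma_dom \<Omega> \<mu> \<Sigma> t) \<and>
    (\<forall>r\<ge>s.
      U_op \<Omega> \<Sigma> r s f \<in> L1_space (phase_measure \<Omega> \<mu>) \<and>
      set_integrable lborel {s..r}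
        (\<lambda>t. L1_norm (phase_measure \<Omega> \<mu>) (B_op \<mu> b t (U_op \<Omega> \<Sigma> t s f))) \<and>
      set_integrable lborel {s..r}
        (\<lambda>t. L1_norm (phase_measure \<Omega> \<mu>) (Sigma_op \<Sigma> t (U_op \<Omega> \<Sigma> t s f))) \<and>
      (LBINT t:{s..r}. L1_norm (phase_measure \<Omega> \<mu>) (B_op \<mu> b t (U_op \<Omega> \<Sigma> t s f)))
        \<le> (LBINT t:{s..r}. L1_norm (phase_measure \<Omega> \<mu>) (Sigma_op \<Sigma> t (U_op \<Omega> \<Sigma> t s f))) \<and>
      (LBINT t:{s..r}. L1_norm (phase_measure \<Omega> \<mu>) (Sigma_op \<Sigma> t (U_op \<Omega> \<Sigma> t s f)))
        \<le> L1_norm (phase_measure \<Omega> \<mu>) f - L1_norm (phase_measure \<Omega> \<mu>) (U_op \<Omega> \<Sigma> r s f))"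
proof -
  interpret collision_transport \<Omega> \<mu> \<Sigma> b
    using assms by (rule collision_transport.intro)
  show ?thesis
  proof (intro allI ballI impI)
    fix s :: real and f :: "'a \<times> 'a \<Rightarrow> real"
    assume s: "0 \<le> s" and "f \<in> L1_cone (phase_measure \<Omega> \<mu>)"
    then have f: "integrable P f" by (simp add: L1_cone_def L1_space_def)
    have dom: "AE t in half_line s. U_op \<Omega> \<Sigma> t s f \<in> B_dom \<Omega> \<mu> b t"
      "AE t in half_line s. U_op \<Omega> \<Sigma> t s f \<in> Sigma_dom \<Omega> \<mu> \<Sigma> t"
      using AE_U_op_in_domains[OF s f] by simp_all
    have "U_op \<Omega> \<Sigma> r s f \<in> L1_space P \<and>
      set_integrable lborel {s..r} (\<lambda>t. L1_norm P (B_op \<mu> b t (U_op \<Omega> \<Sigma> t s f))) \<and>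
      set_integrable lborel {s..r} (\<lambda>t. L1_norm P (Sigma_op \<Sigma> t (U_op \<Omega> \<Sigma> t s f))) \<and>
      (LBINT t:{s..r}. L1_norm P (B_op \<mu> b t (U_op \<Omega> \<Sigma> t s f)))
        \<le> (LBINT t:{s..r}. L1_norm P (Sigma_op \<Sigma> t (U_op \<Omega> \<Sigma> t s f))) \<and>
      (LBINT t:{s..r}. L1_norm P (Sigma_op \<Sigma> t (U_op \<Omega> \<Sigma> t s f)))
        \<le> L1_norm P f - L1_norm P (U_op \<Omega> \<Sigma> r s f)" if "s \<le> r" for r
      using integrable_U_op[OF s that f] set_integral_B_op_le[OF s f] set_integral_Sigma_op_le[OF s that f]
        set_integrable_L1_norm[OF integrable_B_op[OF s f]] set_integrable_L1_norm[OF integrable_Sigma_op[OF s f]]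
      by (simp add: L1_space_def)
    then show "(AE t in half_line s. U_op \<Omega> \<Sigma> t s f \<in> B_dom \<Omega> \<mu> b t) \<and>
      L1_strongly_measurable (half_line s) P (\<lambda>t. B_op \<mu> b t (U_op \<Omega> \<Sigma> t s f)) \<and>
      (AE t in half_line s. U_op \<Omega> \<Sigma> t s f \<in> Sigma_dom \<Omega> \<mu> \<Sigma> t) \<and>
      (\<forall>r\<ge>s. U_op \<Omega> \<Sigma> r s f \<in> L1_space P \<and>
        set_integrable lborel {s..r} (\<lambda>t. L1_norm P (B_op \<mu> b t (U_op \<Omega> \<Sigma> t s f))) \<and>
        set_integrable lborel {s..r} (\<lambda>t. L1_norm P (Sigma_op \<Sigma> t (U_op \<Omega> \<Sigma> t s f))) \<and>
        (LBINT t:{s..r}. L1_norm P (B_op \<mu> b t (U_op \<Omega> \<Sigma> t s f)))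
          \<le> (LBINT t:{s..r}. L1_norm P (Sigma_op \<Sigma> t (U_op \<Omega> \<Sigma> t s f))) \<and>
        (LBINT t:{s..r}. L1_norm P (Sigma_op \<Sigma> t (U_op \<Omega> \<Sigma> t s f)))
          \<le> L1_norm P f - L1_norm P (U_op \<Omega> \<Sigma> r s f))"
      using dom B_op_strongly_measurable[OF s f] by blast
  qed
qed

end
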